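(* The group \[K_2=\langle x,t \mid [x,\ txt^{-1}\,x\,tx^{-1}t^{-1}],\ t^2\rangle,\] which is a one-relator product of the cyclic groups $\mathbb{Z}=\langle x\rangle$ and $C_2=\langle t\mid t^2\rangle$, i.e. of the form $(\mathbb{Z}*C_2)/\langle\langle r\rangle\rangle$, has undecidable Diophantine problem.
   Context: Commutator convention: $[u,v]=uvu^{-1}v^{-1}$. The Diophantine problem for a finitely generated group $G$ asks for an algorithm that, given a finite system of equations over $G$ (elements of $G*F(\mathcal X)$ for a finite set of variables $\mathcal X$), decides whether there is a homomorphism $G*F(\mathcal X)\to G$ restricting to the identity on $G$ and sending each equation to $1$. *)

theory Defs
  imports Main "HOL-Library.Nat_Bijection"
begin

datatype recf = Zf | Sf | Proj nat | Comp recf "recf list" | Prim recf recf | Mn recf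

inductive eval :: "recf \<Rightarrow> nat list \<Rightarrow> nat \<Rightarrow> bool" where
  ev_Z: "eval Zf xs 0"
| ev_S: "eval Sf (x # xs) (Suc x)"
| ev_Proj: "i < length xs \<Longrightarrow> eval (Proj i) xs (xs ! i)"
| ev_Comp: "list_all2 (\<lambda>g y. eval g xs y) gs ys \<Longrightarrow> eval f ys y \<Longrightarrow> eval (Comp f gs) xs y"
| ev_Prim0: "eval f xs y \<Longrightarrow> eval (Prim f g) (0 # xs) y"
| ev_PrimS: "eval (Prim f g) (n # xs) y \<Longrightarrow> eval g (n # y # xs) z
              \<Longrightarrow> eval (Prim f g) (Suc n # xs) z"
| ev_Mn: "eval f (n # xs) 0 \<Longrightarrow> (\<forall>m<n. \<exists>k. eval f (m # xs) (Suc k))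
              \<Longrightarrow> eval (Mn f) xs n"

datatype gen = GX | GT

text \<open>A word is a list of letters (a, inv); inv = True means the inverse letter.\<close>
type_synonym 'a word = "('a \<times> bool) list"

definition winv :: "'a word \<Rightarrow> 'a word" where
  "winv w = rev (map (\<lambda>(a, b). (a, \<not> b)) w)"

abbreviation xx :: "gen word" where "xx \<equiv> [(GX, False)]"
abbreviation tt :: "gen word" where "tt \<equiv> [(GT, False)]"

definition comm :: "'a word \<Rightarrow> 'a word \<Rightarrow> 'a word" where
  "comm u v = u @ v @ winv u @ winv v"

definition v_K2 :: "gen word" where
  "v_K2 = tt @ xx @ winv tt @ xx @ tt @ winv xx @ winv tt"

definition relators_K2 :: "gen word set" where
  "relators_K2 = {comm xx v_K2, tt @ tt}"

inductive eqK2 :: "gen word \<Rightarrow> gen word \<Rightarrow> bool" where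
  eq_refl: "eqK2 w w"
| eq_sym: "eqK2 u v \<Longrightarrow> eqK2 v u"
| eq_trans: "eqK2 u v \<Longrightarrow> eqK2 v w \<Longrightarrow> eqK2 u w"
| eq_app: "eqK2 u u' \<Longrightarrow> eqK2 v v' \<Longrightarrow> eqK2 (u @ v) (u' @ v')"
| eq_cancel: "eqK2 [(a, b), (a, \<not> b)] []"
| eq_rel: "r \<in> relators_K2 \<Longrightarrow> eqK2 r []"

text \<open>An equation is an element of K2 * F(X), represented by a word in constants (Inl) and
  variables (Inr i).  A solution is a homomorphism fixing K2, determined by the images
  (words over x,t) of the variables.\<close>
type_synonym equation = "(gen + nat) word"

definition subst :: "(nat \<Rightarrow> gen word) \<Rightarrow> equation \<Rightarrow> gen word" where
  "subst \<sigma> w = concat (map (\<lambda>(c, b). case c of Inl g \<Rightarrow> [(g, b)]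
                                   | Inr i \<Rightarrow> (if b then winv (\<sigma> i) else \<sigma> i)) w)"

definition solvable_K2 :: "equation list \<Rightarrow> bool" where
  "solvable_K2 sys \<longleftrightarrow> (\<exists>\<sigma>. \<forall>e \<in> set sys. eqK2 (subst \<sigma> e) [])"

fun enc_sym :: "gen + nat \<Rightarrow> nat" where
  "enc_sym (Inl GX) = 0"
| "enc_sym (Inl GT) = 1"
| "enc_sym (Inr i) = i + 2"

definition enc_letter :: "(gen + nat) \<times> bool \<Rightarrow> nat" where
  "enc_letter l = prod_encode (enc_sym (fst l), if snd l then 1 else 0)"

definition enc_system :: "equation list \<Rightarrow> nat" where
  "enc_system sys = list_encode (map (\<lambda>e. list_encode (map enc_letter e)) sys)"

definition diophantine_decidable_K2 :: bool where
  "diophantine_decidable_K2 \<longleftrightarrow>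
     (\<exists>r. \<forall>sys. eval r [enc_system sys] (if solvable_K2 sys then 1 else 0))"

end

theory Submission
  imports Defs "HOL-Number_Theory.Cong" "HOL-Computational_Algebra.Primes"
begin

text \<open>Put \<open>y = txt\<close> and \<open>c = [x, y]\<close>. Together with its conjugate by \<open>t\<close>, the relator
  \<open>[x, yxy\<inverse>]\<close> says exactly that \<open>c\<close> is central in \<open>\<langle>x, y\<rangle>\<close>, so \<open>K\<^sub>2\<close> is the Heisenberg
  group \<open>\<langle>x, y\<rangle>\<close> extended by the involution \<open>t\<close> that swaps \<open>x\<close> and \<open>y\<close>. The centralisers of
  \<open>x\<close> and \<open>y\<close> in \<open>K\<^sub>2\<close> are \<open>\<langle>x, c\<rangle>\<close> and \<open>\<langle>y, c\<rangle>\<close>, and \<open>[x\<^sup>a, y\<^sup>b] = c\<^sup>a\<^sup>b\<close>, so systems of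
  equations over \<open>K\<^sub>2\<close> interpret the ring of integers.

  It remains to solve Hilbert's tenth problem negatively for the given model of computation:
  the graph of every partial recursive function is Diophantine. Exponentiation is Diophantine by
  Matiyasevich's analysis of the Pell equation, hence so are binomial coefficients and
  factorials, and these eliminate bounded universal quantifiers by the Chinese remainder theorem.

  If \<open>r\<close> decided solvability, let \<open>d\<close> map the code \<open>n\<close> of a system to the verdict of \<open>r\<close> on that
  system with its variable \<open>0\<close> set to \<open>x\<^sup>n\<close>. The set \<open>{n. d n = 0}\<close> is Diophantine, so it is
  described by a system, and evaluating \<open>d\<close> at the code of this system gives a contradiction.\<close>

section \<open>Diophantine predicates\<close>

text \<open>The contradiction needs one system for one fixed function \<open>d\<close>, so the
  passage from recursive functions to equations need not be effective, and neither a universal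
  function nor a coding of \<open>recf\<close> is required. Only the map from the code of a system
  to the code of its instance has to be computed by a \<open>recf\<close>. Both \<open>Prim\<close>
  and \<open>Mn\<close> refer to all earlier steps of a computation, whose number is not fixed in
  advance. This forces a bounded universal quantifier, which must be compressed into a fixed number
  of variables; powers, binomial coefficients and factorials serve to describe the moduli of that
  compression. Recursive functions live on the naturals, whereas the exponents found in the group
  are integers. The bridge is an existential definition of nonnegativity in the ring of integers. An
  element of a centraliser is known only up to a power of \<open>c\<close>, so exponents are
  compared through commutators, which discard this factor.\<close>

inductive dioph :: "((nat \<Rightarrow> nat) \<Rightarrow> bool) \<Rightarrow> bool" where
  dioph_const0: "dioph (\<lambda>v. v i = c)"
| dioph_add0: "dioph (\<lambda>v. v i = v j + v k)"
| dioph_mult0: "dioph (\<lambda>v. v i = v j * v k)"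
| dioph_conj: "dioph P \<Longrightarrow> dioph Q \<Longrightarrow> dioph (\<lambda>v. P v \<and> Q v)"
| dioph_ex0: "dioph P \<Longrightarrow> dioph (\<lambda>v. \<exists>x. P (case_nat x v))"

text \<open>\<open>dioph_ex0\<close> binds the variable as de Bruijn index 0. In this form
  higher-order unification recovers \<open>P\<close> from a named quantifier, so that
  \<open>intro\<close> can take apart an explicit formula.\<close>

lemma dioph_ex:
  assumes "dioph (\<lambda>v. P (v 0) (\<lambda>i. v (Suc i)))"
  shows "dioph (\<lambda>v. \<exists>x. P x v)"
  using dioph_ex0[OF assms] by simp

lemma dioph_subst:
  assumes "dioph P"
  shows "dioph (\<lambda>v. P (\<lambda>i. v (f i)))"
  using assms
proof (induction arbitrary: f)
  case (dioph_conj P Q)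
  show ?case by (intro dioph.dioph_conj dioph_conj.IH)
next
  case (dioph_ex0 P)
  have "dioph (\<lambda>v. \<exists>x. P (\<lambda>i. case_nat x v (case_nat 0 (\<lambda>i. Suc (f i)) i)))"
    by (rule dioph.dioph_ex0[where P = "\<lambda>v. P (\<lambda>i. v (case_nat 0 (\<lambda>i. Suc (f i)) i))"])
      (rule dioph_ex0.IH)
  moreover have "(\<lambda>i. case_nat x v (case_nat 0 (\<lambda>i. Suc (f i)) i)) = case_nat x (\<lambda>i. v (f i))"
    for x and v :: "nat \<Rightarrow> nat"
    by (auto split: nat.splits)
  ultimately show ?case by simp
qed (rule dioph_const0 dioph_add0 dioph_mult0)+

lemma dioph_True: "dioph (\<lambda>v. True)"
proof -
  have "dioph (\<lambda>v. \<exists>x::nat. x = 0)"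
    by (rule dioph_ex) (rule dioph_const0)
  then show ?thesis by simp
qed

lemma dioph_var_eq: "dioph (\<lambda>v. v i = v j)"
proof -
  have "dioph (\<lambda>v. \<exists>z. z = 0 \<and> v i = v j + z)"
    by (intro dioph_ex dioph_conj dioph_const0 dioph_add0)
  then show ?thesis by simp
qed

text \<open>An atomic equation is guarded by multiplying both of its sides by \<open>v i\<close>;
  the guard distributes over conjunction and the existential quantifier. This prepares disjunction,
  which is not a primitive of \<open>dioph\<close>.\<close>

lemma dioph_guard:
  assumes "dioph P"
  shows "dioph (\<lambda>v. v i = 0 \<or> P v)"
  using assms
proof (induction arbitrary: i)
  case (dioph_const0 j c)
  have "dioph (\<lambda>v. \<exists>z p q. z = c \<and> p = v i * v j \<and> q = v i * z \<and> p = q)"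
    by (intro dioph_ex dioph_conj dioph.dioph_const0 dioph_mult0 dioph_var_eq)
  then show ?case by (rule back_subst[of dioph]) (rule ext, auto)
next
  case (dioph_add0 j k l)
  have "dioph (\<lambda>v. \<exists>z p q. z = v k + v l \<and> p = v i * v j \<and> q = v i * z \<and> p = q)"
    by (intro dioph_ex dioph_conj dioph.dioph_add0 dioph_mult0 dioph_var_eq)
  then show ?case by (rule back_subst[of dioph]) (rule ext, auto)
next
  case (dioph_mult0 j k l)
  have "dioph (\<lambda>v. \<exists>z p q. z = v k * v l \<and> p = v i * v j \<and> q = v i * z \<and> p = q)"
    by (intro dioph_ex dioph_conj dioph.dioph_mult0 dioph_var_eq)
  then show ?case by (rule back_subst[of dioph]) (rule ext, auto)
next
  case (dioph_conj P Q)
  have "dioph (\<lambda>v. (v i = 0 \<or> P v) \<and> (v i = 0 \<or> Q v))"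
    by (intro dioph.dioph_conj dioph_conj.IH)
  then show ?case by (rule back_subst[of dioph]) (rule ext, auto)
next
  case (dioph_ex0 P)
  have "dioph (\<lambda>v. \<exists>x. case_nat x v (Suc i) = 0 \<or> P (case_nat x v))"
    by (rule dioph.dioph_ex0) (rule dioph_ex0.IH)
  then show ?case by (rule back_subst[of dioph]) (rule ext, auto)
qed

text \<open>Natural numbers with \<open>a + b = 1\<close> cannot both be 0, and the nonzero one
  switches on its disjunct.\<close>

lemma dioph_disj:
  assumes "dioph P" "dioph Q"
  shows "dioph (\<lambda>v. P v \<or> Q v)"
proof -
  have "dioph (\<lambda>v. \<exists>a b c::nat. c = 1 \<and> c = a + b \<and> (a = 0 \<or> P v) \<and> (b = 0 \<or> Q v))"
    by (intro dioph_ex dioph_conj dioph_const0 dioph_add0)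
      (rule dioph_guard, rule dioph_subst[OF assms(1)], rule dioph_guard, rule dioph_subst[OF assms(2)])
  also have "(\<lambda>v. \<exists>a b c::nat. c = 1 \<and> c = a + b \<and> (a = 0 \<or> P v) \<and> (b = 0 \<or> Q v))
      = (\<lambda>v. P v \<or> Q v)"
  proof (rule ext, rule iffI)
    fix v assume "P v \<or> Q v"
    then show "\<exists>a b c::nat. c = 1 \<and> c = a + b \<and> (a = 0 \<or> P v) \<and> (b = 0 \<or> Q v)"
      by (metis add.right_neutral add_0)
  qed auto
  finally show ?thesis .
qed

section \<open>Composition with Diophantine functions\<close>

definition dfun :: "((nat \<Rightarrow> nat) \<Rightarrow> nat) \<Rightarrow> bool" where
  "dfun f \<longleftrightarrow> dioph (\<lambda>v. v 0 = f (\<lambda>i. v (Suc i)))"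

lemma dfun_var: "dfun (\<lambda>v. v i)"
  unfolding dfun_def by (rule dioph_var_eq)

lemma dfun_const: "dfun (\<lambda>v. c)"
  unfolding dfun_def by (rule dioph_const0)

lemma dfun_eq_var:
  assumes "dfun f"
  shows "dioph (\<lambda>v. v k = f (\<lambda>i. v (h i)))"
  using dioph_subst[OF assms[unfolded dfun_def], of "case_nat k h"] by simp

lemma dioph_apply:
  assumes "dioph (\<lambda>v. R (v 0) (\<lambda>i. v (Suc i)))" "dfun f"
  shows "dioph (\<lambda>v. R (f v) v)"
proof -
  have "dioph (\<lambda>v. \<exists>x. x = f v \<and> R x v)"
    by (intro dioph_ex dioph_conj dfun_eq_var[OF assms(2)] assms(1))
  then show ?thesis by simp
qed

lemma dioph_apply2:
  assumes "dioph (\<lambda>v. R (v 0) (v 1))" "dfun f" "dfun g"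
  shows "dioph (\<lambda>v. R (f v) (g v))"
proof -
  have "dioph (\<lambda>v. \<exists>x y. x = f v \<and> y = g v \<and> R x y)"
    \<comment> \<open>The variable \<open>y\<close> is bound last and gets index 0, while
      \<open>x\<close> gets index 1; the renaming swaps them.\<close>
    using dioph_subst[OF assms(1), of "case_nat 1 (\<lambda>_. 0)"]
    by (intro dioph_ex dioph_conj dfun_eq_var[OF assms(2)] dfun_eq_var[OF assms(3)]) simp
  then show ?thesis by simp
qed

lemma dioph_apply3:
  assumes "dioph (\<lambda>v. R (v 0) (v 1) (v 2))" "dfun f" "dfun g" "dfun h"
  shows "dioph (\<lambda>v. R (f v) (g v) (h v))"
proof -
  have "dioph (\<lambda>v. \<exists>x y z. x = f v \<and> y = g v \<and> z = h v \<and> R x y z)"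
    using dioph_subst[OF assms(1), of "\<lambda>i. 2 - i"]
    by (intro dioph_ex dioph_conj dfun_eq_var[OF assms(2)] dfun_eq_var[OF assms(3)]
        dfun_eq_var[OF assms(4)]) (simp add: numeral_2_eq_2)
  then show ?thesis by simp
qed

lemma dfun_apply2:
  assumes "dioph (\<lambda>v. v 0 = F (v 1) (v 2))" "dfun f" "dfun g"
  shows "dfun (\<lambda>v. F (f v) (g v))"
proof -
  have shift: "dfun (\<lambda>v. h (\<lambda>i. v (Suc i)))" if "dfun h" for h
    using dfun_eq_var[OF that, of 0 "\<lambda>i. Suc (Suc i)"] unfolding dfun_def .
  show ?thesis
    unfolding dfun_def
    by (rule dioph_apply3[where R = "\<lambda>x y z. x = F y z", OF assms(1) dfun_var shift shift])
      (fact assms)+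
qed

lemma dfun_apply1:
  assumes "dioph (\<lambda>v. v 0 = F (v 1))" "dfun f"
  shows "dfun (\<lambda>v. F (f v))"
  using dfun_apply2[of "\<lambda>x y. F x", OF assms(1,2,2)] .

lemma dioph_eq: "dfun f \<Longrightarrow> dfun g \<Longrightarrow> dioph (\<lambda>v. f v = g v)"
  by (rule dioph_apply2[where R = "(=)", OF dioph_var_eq])

lemma dfun_add: "dfun f \<Longrightarrow> dfun g \<Longrightarrow> dfun (\<lambda>v. f v + g v)"
  by (rule dfun_apply2[where F = "(+)"]) (rule dioph_add0)

lemma dfun_mult: "dfun f \<Longrightarrow> dfun g \<Longrightarrow> dfun (\<lambda>v. f v * g v)"
  by (rule dfun_apply2[where F = "(*)"]) (rule dioph_mult0)

lemma dfun_Suc: "dfun f \<Longrightarrow> dfun (\<lambda>v. Suc (f v))"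
  using dfun_add[OF _ dfun_const[of 1], of f] by simp

lemmas dioph_intros = dioph_ex dioph_conj dioph_disj dioph_eq dioph_True
  dfun_var dfun_const dfun_add dfun_mult dfun_Suc

lemma dioph_le: "dfun f \<Longrightarrow> dfun g \<Longrightarrow> dioph (\<lambda>v. f v \<le> g v)"
proof (rule dioph_apply2[where R = "(\<le>)"])
  have "dioph (\<lambda>v. \<exists>z. v 1 = v 0 + z)" by (intro dioph_intros)
  then show "dioph (\<lambda>v. v 0 \<le> v 1)" by (simp add: nat_le_iff_add)
qed

lemma dioph_less: "dfun f \<Longrightarrow> dfun g \<Longrightarrow> dioph (\<lambda>v. f v < g v)"
  using dioph_le[OF dfun_Suc, of f g] by (simp add: Suc_le_eq)

lemma dioph_neq: "dfun f \<Longrightarrow> dfun g \<Longrightarrow> dioph (\<lambda>v. f v \<noteq> g v)"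
  using dioph_disj[OF dioph_less dioph_less, of f g g f] by (simp add: nat_neq_iff)

lemma dioph_dvd: "dfun f \<Longrightarrow> dfun g \<Longrightarrow> dioph (\<lambda>v. f v dvd g v)"
proof (rule dioph_apply2[where R = "(dvd)"])
  show "dioph (\<lambda>v. v 0 dvd v 1)" unfolding dvd_def by (intro dioph_intros)
qed

lemmas dioph_order_intros = dioph_intros dioph_le dioph_less dioph_neq dioph_dvd

lemma dfun_diff: "dfun f \<Longrightarrow> dfun g \<Longrightarrow> dfun (\<lambda>v. f v - g v)"
proof (rule dfun_apply2[where F = "(-)"])
  have "dioph (\<lambda>v. v 1 = v 0 + v 2 \<or> v 1 < v 2 \<and> v 0 = 0)" by (intro dioph_order_intros)
  then show "dioph (\<lambda>v. v 0 = v 1 - v 2)" by (rule back_subst[of dioph]) (intro ext, arith)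
qed

lemma dfun_div: "dfun f \<Longrightarrow> dfun g \<Longrightarrow> dfun (\<lambda>v. f v div g v)"
proof (rule dfun_apply2[where F = "(div)"])
  have "dioph (\<lambda>v. (v 2 = 0 \<and> v 0 = 0) \<or> (\<exists>r. r < v 2 \<and> v 1 = v 2 * v 0 + r))"
    by (intro dioph_order_intros)
  moreover have "(\<lambda>v::nat \<Rightarrow> nat. (v 2 = 0 \<and> v 0 = 0) \<or> (\<exists>r. r < v 2 \<and> v 1 = v 2 * v 0 + r))
      = (\<lambda>v. v 0 = v 1 div v 2)"
  proof (rule ext, rule iffI)
    fix v :: "nat \<Rightarrow> nat"
    assume "v 0 = v 1 div v 2"
    then show "(v 2 = 0 \<and> v 0 = 0) \<or> (\<exists>r. r < v 2 \<and> v 1 = v 2 * v 0 + r)"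
      by (metis bot_nat_0.not_eq_extremum div_by_0 mod_less_divisor mult_div_mod_eq)
  qed auto
  ultimately show "dioph (\<lambda>v. v 0 = v 1 div v 2)" by simp
qed

lemma dfun_mod: "dfun f \<Longrightarrow> dfun g \<Longrightarrow> dfun (\<lambda>v. f v mod g v)"
  unfolding modulo_nat_def by (intro dfun_diff dfun_mult dfun_div)

lemma dioph_cong: "dfun f \<Longrightarrow> dfun g \<Longrightarrow> dfun h \<Longrightarrow> dioph (\<lambda>v. [f v = g v] (mod h v))"
  unfolding cong_def by (intro dioph_eq dfun_mod)

lemmas dioph_arith_intros = dioph_order_intros dfun_diff dfun_div dfun_mod dioph_cong

lemma dioph_ex_many:
  assumes "dioph P"
  shows "dioph (\<lambda>v. \<exists>w. P (\<lambda>i. if i < m then w i else v (i - m)))"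
proof (induction m)
  case 0
  show ?case using assms by simp
next
  case (Suc m)
  have "dioph (\<lambda>v. \<exists>x w. P (\<lambda>i. if i < m then w i else case_nat x v (i - m)))"
    by (rule dioph_ex0[OF Suc])
  moreover have "(\<exists>x w. P (\<lambda>i. if i < m then w i else case_nat x v (i - m)))
      \<longleftrightarrow> (\<exists>w. P (\<lambda>i. if i < Suc m then w i else v (i - Suc m)))" for v
  proof safe
    fix x w assume P: "P (\<lambda>i. if i < m then w i else case_nat x v (i - m))"
    have "(\<lambda>i. if i < m then w i else case_nat x v (i - m))
        = (\<lambda>i. if i < Suc m then (w(m := x)) i else v (i - Suc m))"
      by (auto simp: fun_eq_iff less_Suc_eq not_less Suc_diff_Suc split: nat.splits)
        (rule arg_cong[of _ _ v], arith)
    with P show "\<exists>w. P (\<lambda>i. if i < Suc m then w i else v (i - Suc m))" by metis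
  next
    fix w assume P: "P (\<lambda>i. if i < Suc m then w i else v (i - Suc m))"
    have "(\<lambda>i. if i < Suc m then w i else v (i - Suc m))
        = (\<lambda>i. if i < m then w i else case_nat (w m) v (i - m))"
      by (auto simp: fun_eq_iff less_Suc_eq not_less split: nat.splits)
        (rule arg_cong[of _ _ v], arith)
    with P show "\<exists>x w. P (\<lambda>i. if i < m then w i else case_nat x v (i - m))" by metis
  qed
  ultimately show ?case by simp
qed

lemma dioph_all_less:
  "(\<And>j. j < (m::nat) \<Longrightarrow> dioph (P j)) \<Longrightarrow> dioph (\<lambda>v. \<forall>j<m. P j v)"
proof (induction m)
  case (Suc m)
  then have "dioph (\<lambda>v. (\<forall>j<m. P j v) \<and> P m v)" by (intro dioph_conj) auto
  then show ?case by (rule back_subst[of dioph]) (auto simp: less_Suc_eq)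
qed (simp add: dioph_True)

lemma dioph_ball_list:
  assumes "\<And>c. c \<in> set cs \<Longrightarrow> dioph (P c)"
  shows "dioph (\<lambda>v. \<forall>c\<in>set cs. P c v)"
  using dioph_all_less[of "length cs" "\<lambda>j. P (cs ! j)"] assms
  by (simp add: all_set_conv_all_nth)

section \<open>Normal form: finite lists of elementary constraints\<close>

datatype 'a cstr = Const_eq 'a nat | Add_eq 'a 'a 'a | Mult_eq 'a 'a 'a

text \<open>Polymorphic in the semiring, because the same constraints are read over the naturals and
  over the integers.\<close>

fun holds :: "('a \<Rightarrow> 'b::comm_semiring_1) \<Rightarrow> 'a cstr \<Rightarrow> bool" where
  "holds \<rho> (Const_eq a c) \<longleftrightarrow> \<rho> a = of_nat c"
| "holds \<rho> (Add_eq a b c) \<longleftrightarrow> \<rho> a = \<rho> b + \<rho> c"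
| "holds \<rho> (Mult_eq a b c) \<longleftrightarrow> \<rho> a = \<rho> b * \<rho> c"

lemma holds_map: "holds \<rho> (map_cstr f c) \<longleftrightarrow> holds (\<lambda>i. \<rho> (f i)) c"
  by (cases c) auto

text \<open>In a constraint list \<^term>\<open>Inl i\<close> is an existentially quantified variable and
  \<^term>\<open>Inr i\<close> a parameter.\<close>

lemma dioph_normal_form:
  assumes "dioph P"
  shows "\<exists>cs. \<forall>v. P v \<longleftrightarrow> (\<exists>w :: nat \<Rightarrow> nat. \<forall>c\<in>set cs. holds (case_sum w v) c)"
  using assms
proof induction
  case (dioph_const0 i c)
  show ?case by (rule exI[of _ "[Const_eq (Inr i) c]"]) simp
next
  case (dioph_add0 i j k)
  show ?case by (rule exI[of _ "[Add_eq (Inr i) (Inr j) (Inr k)]"]) simp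
next
  case (dioph_mult0 i j k)
  show ?case by (rule exI[of _ "[Mult_eq (Inr i) (Inr j) (Inr k)]"]) simp
next
  case (dioph_conj P Q)
  then obtain cs ds where
    cs: "\<And>v. P v \<longleftrightarrow> (\<exists>w :: nat \<Rightarrow> nat. \<forall>c\<in>set cs. holds (case_sum w v) c)" and
    ds: "\<And>v. Q v \<longleftrightarrow> (\<exists>w :: nat \<Rightarrow> nat. \<forall>c\<in>set ds. holds (case_sum w v) c)"
    by metis
  \<comment> \<open>The witnesses of the two conjuncts are kept apart at even and odd
    indices.\<close>
  let ?f = "case_sum (\<lambda>i. Inl (2 * i)) Inr :: nat + nat \<Rightarrow> nat + nat"
  let ?g = "case_sum (\<lambda>i. Inl (Suc (2 * i))) Inr :: nat + nat \<Rightarrow> nat + nat"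
  have f: "(\<lambda>i. case_sum w v (?f i)) = case_sum (\<lambda>i. w (2 * i)) v" for w v :: "nat \<Rightarrow> nat"
    by (auto simp: fun_eq_iff split: sum.splits)
  have g: "(\<lambda>i. case_sum w v (?g i)) = case_sum (\<lambda>i. w (Suc (2 * i))) v" for w v :: "nat \<Rightarrow> nat"
    by (auto simp: fun_eq_iff split: sum.splits)
  show ?case
  proof (rule exI[of _ "map (map_cstr ?f) cs @ map (map_cstr ?g) ds"], rule allI, rule iffI)
    fix v :: "nat \<Rightarrow> nat" assume "P v \<and> Q v"
    then obtain w w' where w: "\<forall>c\<in>set cs. holds (case_sum w v) c"
      and w': "\<forall>c\<in>set ds. holds (case_sum w' v) c"
      using cs ds by blast
    let ?w = "\<lambda>i. if even i then w (i div 2) else w' (i div 2)"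
    have "\<forall>c\<in>set (map (map_cstr ?f) cs @ map (map_cstr ?g) ds). holds (case_sum ?w v) c"
      using w w' by (auto simp: holds_map f g)
    then show "\<exists>w. \<forall>c\<in>set (map (map_cstr ?f) cs @ map (map_cstr ?g) ds). holds (case_sum w v) c"
      by blast
  next
    fix v :: "nat \<Rightarrow> nat"
    assume "\<exists>w. \<forall>c\<in>set (map (map_cstr ?f) cs @ map (map_cstr ?g) ds). holds (case_sum w v) c"
    then obtain w where "\<forall>c\<in>set cs. holds (case_sum (\<lambda>i. w (2 * i)) v) c"
      "\<forall>c\<in>set ds. holds (case_sum (\<lambda>i. w (Suc (2 * i))) v) c"
      by (auto simp: ball_Un holds_map f g)
    then show "P v \<and> Q v"
      unfolding cs ds by blast
  qed
next
  case (dioph_ex0 P)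
  then obtain cs where
    cs: "\<And>v. P v \<longleftrightarrow> (\<exists>w :: nat \<Rightarrow> nat. \<forall>c\<in>set cs. holds (case_sum w v) c)"
    by metis
  let ?f = "case_sum (\<lambda>i. Inl (Suc i)) (case_nat (Inl 0) Inr) :: nat + nat \<Rightarrow> nat + nat"
  have f: "(\<lambda>i. case_sum w v (?f i)) = case_sum (\<lambda>i. w (Suc i)) (case_nat (w 0) v)"
    for w v :: "nat \<Rightarrow> nat"
    by (auto simp: fun_eq_iff split: sum.splits nat.splits)
  show ?case
  proof (rule exI[of _ "map (map_cstr ?f) cs"], rule allI, rule iffI)
    fix v :: "nat \<Rightarrow> nat" assume "\<exists>x. P (case_nat x v)"
    then obtain x w where "\<forall>c\<in>set cs. holds (case_sum w (case_nat x v)) c"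
      using cs by blast
    then have "\<forall>c\<in>set (map (map_cstr ?f) cs). holds (case_sum (case_nat x w) v) c"
      by (simp add: holds_map f)
    then show "\<exists>w. \<forall>c\<in>set (map (map_cstr ?f) cs). holds (case_sum w v) c" by blast
  next
    fix v :: "nat \<Rightarrow> nat" assume "\<exists>w. \<forall>c\<in>set (map (map_cstr ?f) cs). holds (case_sum w v) c"
    then obtain w where "\<forall>c\<in>set cs. holds (case_sum (\<lambda>i. w (Suc i)) (case_nat (w 0) v)) c"
      by (auto simp: holds_map f)
    then show "\<exists>x. P (case_nat x v)"
      unfolding cs by blast
  qed
qed

section \<open>The Pell equation\<close>

text \<open>The coefficients of
  \<open>(a + sqrt (a^2 - 1))^n = px a n + py a n * sqrt (a^2 - 1)\<close>.\<close>

fun px :: "int \<Rightarrow> nat \<Rightarrow> int" and py :: "int \<Rightarrow> nat \<Rightarrow> int" where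
  "px a 0 = 1"
| "px a (Suc n) = a * px a n + (a\<^sup>2 - 1) * py a n"
| "py a 0 = 0"
| "py a (Suc n) = px a n + a * py a n"

lemma pell_eq: "(px a n)\<^sup>2 - (a\<^sup>2 - 1) * (py a n)\<^sup>2 = 1"
proof (induction n)
  case (Suc n)
  have "(px a (Suc n))\<^sup>2 - (a\<^sup>2 - 1) * (py a (Suc n))\<^sup>2 = (px a n)\<^sup>2 - (a\<^sup>2 - 1) * (py a n)\<^sup>2"
    by (simp add: power2_eq_square algebra_simps)
  then show ?case using Suc by simp
qed simp

lemma px_py_add:
  "px a (m + n) = px a m * px a n + (a\<^sup>2 - 1) * (py a m * py a n) \<and>
   py a (m + n) = px a m * py a n + py a m * px a n"
proof (induction n)
  case (Suc n)
  then have IH: "px a (m + n) = px a m * px a n + (a\<^sup>2 - 1) * (py a m * py a n)"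
    "py a (m + n) = px a m * py a n + py a m * px a n" by auto
  show ?case by (simp add: IH) (simp add: algebra_simps)
qed simp

lemmas px_add = px_py_add[THEN conjunct1]
lemmas py_add = px_py_add[THEN conjunct2]

lemma coprime_px_py: "coprime (px a n) (py a n)"
proof (rule coprimeI)
  fix c assume "c dvd px a n" "c dvd py a n"
  then have "c dvd (px a n)\<^sup>2 - (a\<^sup>2 - 1) * (py a n)\<^sup>2"
    by (simp add: power2_eq_square)
  then show "is_unit c" by (simp only: pell_eq)
qed

lemma px_py_pos:
  assumes "a \<ge> 2"
  shows "px a n > 0" "py a n \<ge> 0"
proof -
  have "a\<^sup>2 \<ge> 1" using power_mono[of 1 a 2] assms by simp
  have "px a n > 0 \<and> py a n \<ge> 0"
  proof (induction n)
    case (Suc n)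
    have "a * px a n > 0" "(a\<^sup>2 - 1) * py a n \<ge> 0" "a * py a n \<ge> 0"
      using Suc assms \<open>a\<^sup>2 \<ge> 1\<close> by auto
    then show ?case using Suc by auto
  qed simp
  then show "px a n > 0" "py a n \<ge> 0" by auto
qed

lemma px_double_le: "a \<ge> 2 \<Longrightarrow> 2 * px a n \<le> px a (Suc n)"
proof -
  assume a: "a \<ge> 2"
  have "a\<^sup>2 \<ge> 1" using power_mono[of 1 a 2] a by simp
  then have "(a\<^sup>2 - 1) * py a n \<ge> 0" using px_py_pos[OF a, of n] by (intro mult_nonneg_nonneg) auto
  moreover have "2 * px a n \<le> a * px a n" using px_py_pos[OF a, of n] a by simp
  ultimately show ?thesis by simp
qed

lemma px_strict_mono: "a \<ge> 2 \<Longrightarrow> i < j \<Longrightarrow> px a i < px a j"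
proof (induction j)
  case (Suc j)
  then show ?case using px_double_le[of a j] px_py_pos[of a j] less_Suc_eq by fastforce
qed simp

lemma py_strict_mono: "a \<ge> 2 \<Longrightarrow> i < j \<Longrightarrow> py a i < py a j"
proof (induction j)
  case (Suc j)
  have "py a j \<le> a * py a j" using px_py_pos[OF Suc(2), of j] Suc(2)
    by (simp add: mult_le_cancel_right1)
  then have "py a j < py a (Suc j)" using px_py_pos[OF Suc(2), of j] by simp
  then show ?case using Suc less_Suc_eq by fastforce
qed simp

lemma py_ge_index: "a \<ge> 2 \<Longrightarrow> int n \<le> py a n"
proof (induction n)
  case (Suc n)
  then show ?case using py_strict_mono[OF Suc.prems, of n "Suc n"] by simp
qed simp

lemma py_ge_power: "a \<ge> 2 \<Longrightarrow> a ^ n \<le> py a (Suc n)"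
proof (induction n)
  case (Suc n)
  have "a * a ^ n \<le> a * py a (Suc n)" using Suc by (intro mult_left_mono) auto
  then show ?case using px_py_pos[OF Suc.prems, of "Suc n"]
    unfolding py.simps(2)[of a "Suc n"] by (simp del: py.simps px.simps)
qed simp

text \<open>Descent: multiplying \<open>x + y * sqrt (a^2 - 1)\<close> by the inverse
  \<open>a - sqrt (a^2 - 1)\<close> of the fundamental unit gives a solution \<open>(x', y')\<close>
  with \<open>0 <= y' < y\<close>, and this ends at \<open>(1, 0)\<close>.\<close>

lemma pell_solution:
  assumes "a \<ge> 2" "x \<ge> 0" "y \<ge> 0" "x\<^sup>2 - (a\<^sup>2 - 1) * y\<^sup>2 = (1::int)"
  shows "\<exists>n. x = px a n \<and> y = py a n"
  using assms(2-4)
proof (induction "nat y" arbitrary: x y rule: less_induct)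
  case less
  show ?case
  proof (cases "y = 0")
    case True
    with less.prems have "x = 1"
      by (simp add: power2_eq_1_iff)
    with True show ?thesis by (intro exI[of _ 0]) simp
  next
    case False
    with less.prems have y: "y \<ge> 1" by simp
    have a0: "a \<ge> 0" using assms(1) by simp
    define x' where "x' = a * x - (a\<^sup>2 - 1) * y"
    define y' where "y' = a * y - x"
    have y2: "y\<^sup>2 \<ge> 1" using y power_mono[of 1 y 2] by simp
    have xsq: "x\<^sup>2 = a\<^sup>2 * y\<^sup>2 - y\<^sup>2 + 1" using less.prems(3) by (simp add: algebra_simps)
    have "x\<^sup>2 \<le> (a * y)\<^sup>2" using xsq y2 by (simp add: power_mult_distrib)
    then have "y' \<ge> 0"
      using power2_le_imp_le[of x "a * y"] a0 y unfolding y'_def by auto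
    have "((a - 1) * y)\<^sup>2 = a\<^sup>2 * y\<^sup>2 - y\<^sup>2 - 2 * ((a - 1) * y\<^sup>2)"
      by (simp add: power2_eq_square algebra_simps)
    moreover have "(a - 1) * y\<^sup>2 \<ge> 0" using assms(1) by simp
    ultimately have "((a - 1) * y)\<^sup>2 < x\<^sup>2" using xsq by linarith
    then have "(a - 1) * y < x" using power2_less_imp_less less.prems(1) by blast
    then have "y' < y" unfolding y'_def by (simp add: algebra_simps)
    have a2: "a\<^sup>2 \<ge> 1" using power_mono[of 1 a 2] assms by simp
    have "(a * x)\<^sup>2 - ((a\<^sup>2 - 1) * y)\<^sup>2 = a\<^sup>2 * (x\<^sup>2 - (a\<^sup>2 - 1) * y\<^sup>2) + (a\<^sup>2 - 1) * y\<^sup>2"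
      by (simp add: power2_eq_square algebra_simps)
    also have "\<dots> \<ge> 0"
      unfolding less.prems(3) using a2 by (intro add_nonneg_nonneg mult_nonneg_nonneg) auto
    finally have "((a\<^sup>2 - 1) * y)\<^sup>2 \<le> (a * x)\<^sup>2" by simp
    then have "x' \<ge> 0"
      using power2_le_imp_le[of "(a\<^sup>2 - 1) * y" "a * x"] a0 less.prems(1) unfolding x'_def by auto
    have "x'\<^sup>2 - (a\<^sup>2 - 1) * y'\<^sup>2 = x\<^sup>2 - (a\<^sup>2 - 1) * y\<^sup>2"
      unfolding x'_def y'_def by (simp add: power2_eq_square algebra_simps)
    then have "x'\<^sup>2 - (a\<^sup>2 - 1) * y'\<^sup>2 = 1" using less.prems by simp
    then obtain n where n: "x' = px a n" "y' = py a n"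
      using less.hyps[of y' x'] \<open>y' < y\<close> \<open>y' \<ge> 0\<close> \<open>x' \<ge> 0\<close> by auto
    have "x = a * x' + (a\<^sup>2 - 1) * y'" "y = x' + a * y'"
      unfolding x'_def y'_def by (simp_all add: power2_eq_square algebra_simps)
    then show ?thesis using n by (intro exI[of _ "Suc n"]) simp
  qed
qed

section \<open>Divisibility between Pell solutions and their indices\<close>

lemma py_dvd_py_mult: "py a k dvd py a (k * q)"
proof (induction q)
  case (Suc q)
  then show ?case by (simp add: py_add)
qed simp

lemma px_mult_cong: "[px a (k * q) = px a k ^ q] (mod py a k)"
proof (induction q)
  case (Suc q)
  have "[px a k * px a (k * q) + (a\<^sup>2 - 1) * (py a k * py a (k * q)) = px a k * px a k ^ q + 0] (mod py a k)"
    using Suc by (intro cong_add cong_mult cong_refl) (simp_all add: cong_0_iff)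
  then show ?case by (simp add: px_add)
qed simp

text \<open>In the binomial expansion of \<open>(px a k + py a k * sqrt (a^2 - 1))^(q + 1)\<close>
  only the term linear in \<open>py a k\<close> contributes to the second coefficient modulo
  \<open>(py a k)^2\<close>.\<close>

lemma py_mult_cong: "[py a (k * Suc q) = int (Suc q) * px a k ^ q * py a k] (mod (py a k)\<^sup>2)"
proof (induction q)
  case (Suc q)
  have "py a k * py a k dvd (px a (k * Suc q) - px a k ^ Suc q) * py a k"
    using px_mult_cong[of a k "Suc q"] by (intro mult_dvd_mono) (simp_all add: cong_iff_dvd_diff)
  then have 1: "[px a (k * Suc q) * py a k = px a k ^ Suc q * py a k] (mod (py a k)\<^sup>2)"
    by (simp add: cong_iff_dvd_diff power2_eq_square algebra_simps)
  have "k * Suc (Suc q) = k * Suc q + k" by simp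
  then have "py a (k * Suc (Suc q)) = px a (k * Suc q) * py a k + py a (k * Suc q) * px a k"
    using py_add[of a "k * Suc q" k] by presburger
  also have "[\<dots> = px a k ^ Suc q * py a k + int (Suc q) * px a k ^ q * py a k * px a k] (mod (py a k)\<^sup>2)"
    by (intro cong_add cong_mult 1 Suc cong_refl)
  also have "px a k ^ Suc q * py a k + int (Suc q) * px a k ^ q * py a k * px a k
      = int (Suc (Suc q)) * px a k ^ Suc q * py a k"
    by (simp add: algebra_simps)
  finally show ?case .
qed simp

text \<open>With \<open>n = k * q + r\<close>, the addition formula leaves \<open>py a k\<close>
  dividing \<open>px a (k * q) * py a r\<close>. The first factor is coprime to
  \<open>py a k\<close> and the second is smaller than it, so \<open>r = 0\<close>.\<close>

lemma index_dvd_if_py_dvd: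
  assumes "a \<ge> 2" "k > 0" "py a k dvd py a n"
  shows "k dvd n"
proof -
  define q r where "q = n div k" and "r = n mod k"
  have n: "n = k * q + r" and r: "r < k" using assms(2) unfolding q_def r_def by auto
  have "py a k dvd px a (k * q) * py a r + py a (k * q) * px a r"
    using assms(3) py_add[of a "k * q" r] n by simp
  then have "py a k dvd px a (k * q) * py a r"
    using py_dvd_py_mult[of a k q] by (metis dvd_add_left_iff dvd_mult2)
  moreover have "coprime (py a k) (px a (k * q))"
    using coprime_px_py[of a "k * q"] py_dvd_py_mult[of a k q]
    by (meson coprime_commute coprime_divisors dvd_refl)
  ultimately have "py a k dvd py a r" by (simp add: coprime_dvd_mult_right_iff)
  moreover have "py a r < py a k" using py_strict_mono[OF assms(1) r] .
  ultimately have "py a r = 0"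
    using px_py_pos[OF assms(1), of r] zdvd_imp_le by fastforce
  then have "r = 0" using py_ge_index[OF assms(1), of r] by simp
  then show ?thesis using n by simp
qed

text \<open>Turns a divisibility between solutions, which is Diophantine, into one about the index,
  which is not directly accessible. Cancelling \<open>py a k\<close> and the coprime power of
  \<open>px a k\<close> in \<open>py_mult_cong\<close> leaves the cofactor of the index.\<close>

lemma py_dvd_index_if_sq_dvd:
  assumes "a \<ge> 2" "k > 0" "(py a k)\<^sup>2 dvd py a n"
  shows "py a k dvd int n"
proof (cases "n = 0")
  case False
  have "py a k dvd py a n" using assms(3) by (metis dvd_trans dvd_triv_left power2_eq_square)
  then have "k dvd n" using index_dvd_if_py_dvd assms by blast
  then obtain q where n: "n = k * Suc q"
    using False by (metis dvd_def mult_0_right not0_implies_Suc)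
  have "(py a k)\<^sup>2 dvd int (Suc q) * px a k ^ q * py a k"
    using assms(3) py_mult_cong[of a k q] n cong_dvd_iff cong_iff_dvd_diff
    by (metis cong_dvd_modulus cong_sym cong_0_iff cong_trans)
  moreover have "py a k \<noteq> 0" using py_ge_index[OF assms(1), of k] assms(2) by simp
  ultimately have "py a k dvd int (Suc q) * px a k ^ q"
    by (simp add: power2_eq_square)
  moreover have "coprime (py a k) (px a k ^ q)"
    using coprime_px_py[of a k] by (simp add: coprime_commute)
  ultimately have "py a k dvd int (Suc q)" by (simp add: coprime_dvd_mult_left_iff)
  then show ?thesis unfolding n of_nat_mult by (rule dvd_mult)
qed simp

lemma py_sq_dvd: "a \<ge> 2 \<Longrightarrow> (py a k)\<^sup>2 dvd py a (k * nat (py a k))"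
proof (cases "nat (py a k)")
  case (Suc q)
  assume a: "a \<ge> 2"
  have "int (Suc q) = py a k" using Suc px_py_pos[OF a, of k] by linarith
  then have "(py a k)\<^sup>2 dvd int (Suc q) * px a k ^ q * py a k" by (simp add: power2_eq_square)
  then show ?thesis using py_mult_cong[of a k q] Suc
    by (metis cong_0_iff cong_trans)
qed simp

text \<open>Since \<open>a\<close> is 1 and \<open>a^2 - 1\<close> is 0 modulo \<open>a - 1\<close>,
  the recursion keeps \<open>px\<close> fixed and adds 1 to \<open>py\<close> at each step.\<close>

lemma px_py_cong_index: "[px a n = 1] (mod (a - 1)) \<and> [py a n = int n] (mod (a - 1))"
proof (induction n)
  case (Suc n)
  have a: "[a = 1] (mod (a - 1))" "[a\<^sup>2 - 1 = 0] (mod (a - 1))"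
    by (simp_all add: cong_iff_dvd_diff power2_eq_square) (metis dvd_triv_left square_diff_one_factored mult.commute)
  have "[a * px a n + (a\<^sup>2 - 1) * py a n = 1 * 1 + 0 * int n] (mod (a - 1))"
    "[px a n + a * py a n = 1 + 1 * int n] (mod (a - 1))"
    using Suc a by (intro cong_add cong_mult; simp)+
  then show ?case by simp
qed simp

lemma px_py_cong_base:
  assumes "[a = b] (mod c)"
  shows "[px a n = px b n] (mod c) \<and> [py a n = py b n] (mod c)"
proof (induction n)
  case (Suc n)
  then show ?case using assms by (auto intro!: cong_add cong_mult cong_diff cong_pow)
qed simp

text \<open>Modulo \<open>2ak - k^2 - 1\<close> the number \<open>k\<close> is a root of
  \<open>z^2 - 2az + 1\<close>, the characteristic polynomial of the Pell recurrence, and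
  \<open>px - (a - k) py\<close> starts with the values 1 and \<open>k\<close>.\<close>

lemma px_py_power:
  "(2 * a * k - k\<^sup>2 - 1) dvd px a n - (a - k) * py a n - k ^ n"
proof (induction n)
  case (Suc n)
  have "px a (Suc n) - (a - k) * py a (Suc n) - k ^ Suc n
      = k * (px a n - (a - k) * py a n - k ^ n) + (2 * a * k - k\<^sup>2 - 1) * py a n"
    by (simp add: power2_eq_square algebra_simps)
  then show ?case using Suc by simp
qed simp

section \<open>Recovering an index from a residue modulo a Pell solution\<close>

lemma px_add_double: "px a n dvd px a (2 * n + r) + px a r"
proof -
  have "px a (2 * n + r) + px a r
      = px a n * px a (n + r) + (a\<^sup>2 - 1) * (py a n * (px a n * py a r + py a n * px a r)) + px a r"
    using px_add[of a n "n + r"] py_add[of a n r] by (simp add: mult_2 add.assoc)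
  also have "\<dots> = px a n * px a (n + r) + px a n * ((a\<^sup>2 - 1) * py a n * py a r)
      + ((a\<^sup>2 - 1) * (py a n)\<^sup>2 + 1) * px a r"
    by (simp add: power2_eq_square algebra_simps)
  also have "(a\<^sup>2 - 1) * (py a n)\<^sup>2 + 1 = (px a n)\<^sup>2" using pell_eq[of a n] by simp
  finally show ?thesis by (simp add: power2_eq_square)
qed

lemma px_diff_double:
  assumes "m + r = 2 * n"
  shows "px a n dvd px a m + px a r"
proof -
  have dbl: "px a (2 * n) = 2 * (px a n)\<^sup>2 - 1" "py a (2 * n) = px a n * (2 * py a n)"
    using px_add[of a n n] py_add[of a n n] pell_eq[of a n]
    by (simp_all add: power2_eq_square algebra_simps flip: mult_2_right)
  have "px a m = px a m * ((px a r)\<^sup>2 - (a\<^sup>2 - 1) * (py a r)\<^sup>2)" by (simp only: pell_eq mult_1_right)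
  also have "\<dots> = px a (m + r) * px a r - (a\<^sup>2 - 1) * (py a (m + r) * py a r)"
    unfolding px_add py_add by (simp add: power2_eq_square algebra_simps)
  finally have "px a m + px a r = px a n * (2 * px a n * px a r - (a\<^sup>2 - 1) * (2 * py a n * py a r))"
    unfolding assms dbl by (simp add: power2_eq_square algebra_simps)
  then show ?thesis by simp
qed

text \<open>Modulo \<open>px a n\<close> a shift of the index by \<open>2n\<close>, or its
  reflection to \<open>2n - j\<close>, only changes the sign of \<open>px\<close>, and these moves
  fold every index into \<open>0..n\<close>. The signs in the two disjunctions are not correlated;
  the index is only wanted modulo \<open>2n\<close> up to sign.\<close>

lemma px_reduce_index:
  assumes "n > 0"
  shows "\<exists>r\<le>n. (px a n dvd px a j - px a r \<or> px a n dvd px a j + px a r) \<and>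
     (2 * int n dvd int j - int r \<or> 2 * int n dvd int j + int r)"
proof (induction j rule: less_induct)
  case (less j)
  consider "j \<le> n" | "n < j" "j \<le> 2 * n" | "2 * n < j" by linarith
  then show ?case
  proof cases
    case 1
    then show ?thesis by (intro exI[of _ j]) simp
  next
    case 2
    then have "px a n dvd px a j + px a (2 * n - j)" by (intro px_diff_double) simp
    moreover have "int j + int (2 * n - j) = 2 * int n" using 2 by linarith
    ultimately show ?thesis using 2 by (intro exI[of _ "2 * n - j"]) auto
  next
    case 3
    define i where "i = j - 2 * n"
    have j: "j = 2 * n + i" "i < j" using 3 assms unfolding i_def by auto
    from less[OF j(2)] obtain r where r: "r \<le> n"
      "px a n dvd px a i - px a r \<or> px a n dvd px a i + px a r"
      "2 * int n dvd int i - int r \<or> 2 * int n dvd int i + int r" by blast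
    have "px a n dvd px a j + px a i" using px_add_double[of a n i] j by simp
    then have "px a n dvd px a j - px a r \<or> px a n dvd px a j + px a r"
      using r(2) dvd_diff[of "px a n" "px a j + px a i" "px a i - px a r"]
        dvd_diff[of "px a n" "px a j + px a i" "px a i + px a r"] by auto
    moreover have "int j - int r = 2 * int n + (int i - int r)"
      "int j + int r = 2 * int n + (int i + int r)" using j by auto
    ultimately show ?thesis using r(1,3) by (intro exI[of _ r]) (simp only: dvd_add_triv_left_iff simp_thms)
  qed
qed

text \<open>\<open>px\<close> at least doubles at each step, so for \<open>r < n\<close> sum and
  difference lie strictly between 0 and \<open>px a n\<close>. For \<open>r = n\<close> the modulus
  would have to divide the smaller positive \<open>px a i\<close>.\<close>

lemma px_residue_distinct:
  assumes "a \<ge> 2" "i < r" "r \<le> n"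
  shows "\<not> px a n dvd px a r - px a i" "\<not> px a n dvd px a r + px a i"
proof -
  have pos: "px a i > 0" using px_py_pos[OF assms(1)] by blast
  have lt: "px a i < px a r" using px_strict_mono[OF assms(1,2)] .
  have "\<not> px a n dvd px a r - px a i \<and> \<not> px a n dvd px a r + px a i"
  proof (cases "r = n")
    case True
    have "\<not> px a n dvd px a i" using pos lt True zdvd_imp_le by fastforce
    then show ?thesis using True by (simp add: dvd_diff_right_iff dvd_add_right_iff)
  next
    case False
    then have "px a (Suc r) \<le> px a n"
      using px_strict_mono[OF assms(1), of "Suc r" n] assms(3) by (cases "Suc r = n") auto
    then have "px a r + px a i < px a n" using px_double_le[OF assms(1), of r] lt by linarith
    then show ?thesis using pos lt zdvd_imp_le by fastforce
  qed
  then show "\<not> px a n dvd px a r - px a i" "\<not> px a n dvd px a r + px a i" by auto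
qed

lemma px_step_down:
  assumes "a \<ge> 2" "n > 0" "i \<le> n" "px a n dvd px a j - px a i"
  shows "2 * int n dvd int j - int i \<or> 2 * int n dvd int j + int i"
proof -
  obtain r where r: "r \<le> n" "px a n dvd px a j - px a r \<or> px a n dvd px a j + px a r"
     "2 * int n dvd int j - int r \<or> 2 * int n dvd int j + int r"
    using px_reduce_index[OF assms(2)] by blast
  have "px a n dvd px a i - px a r \<or> px a n dvd px a i + px a r"
    using r(2) dvd_diff[OF _ assms(4), of "px a j - px a r"] dvd_diff[OF _ assms(4), of "px a j + px a r"]
    by (auto simp: algebra_simps)
  then have "px a n dvd px a r - px a i \<or> px a n dvd px a r + px a i"
    by (metis add.commute dvd_minus_iff minus_diff_eq)
  then have "i = r"
    using px_residue_distinct[OF assms(1), of i r n] px_residue_distinct[OF assms(1), of r i n]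
      r(1) assms(3) \<open>px a n dvd px a i - px a r \<or> px a n dvd px a i + px a r\<close>
    by (metis linorder_neqE_nat)
  then show ?thesis using r(3) by simp
qed

definition pell_cond :: "nat \<Rightarrow> nat \<Rightarrow> nat \<Rightarrow> bool" where
  "pell_cond a x y \<longleftrightarrow> x * x = (a * a - 1) * (y * y) + 1"

lemma pell_cond_iff:
  assumes "a \<ge> 2"
  shows "pell_cond a x y \<longleftrightarrow> (\<exists>n. int x = px (int a) n \<and> int y = py (int a) n)"
proof -
  have "a * a \<ge> 1" using assms by (cases a) auto
  then have "pell_cond a x y \<longleftrightarrow> (int x)\<^sup>2 - ((int a)\<^sup>2 - 1) * (int y)\<^sup>2 = 1"
    unfolding pell_cond_def
    by (simp add: power2_eq_square algebra_simps flip: of_nat_eq_iff[where 'a = int])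
  then show ?thesis
    using pell_solution[of "int a" "int x" "int y"] assms pell_eq by auto
qed

text \<open>The auxiliary solution \<open>(s, t)\<close> to the base \<open>b\<close> has an index \<open>j\<close> that is congruent to \<open>k\<close>
  modulo \<open>2 * y\<close>, since \<open>b \<equiv> 1\<close>, and to plus or minus the index of \<open>(x, y)\<close>, since \<open>b \<equiv> a\<close>
  modulo \<open>u\<close>.\<close>

lemma py_characterization:
  fixes a k y :: nat
  assumes a: "a \<ge> 2" and k: "k \<ge> 1"
  shows "int y = py (int a) k \<longleftrightarrow> k \<le> y \<and> (\<exists>x u v s t b. pell_cond a x y \<and> pell_cond a u v \<and>
    pell_cond b s t \<and> 0 < v \<and> 2 \<le> b \<and> y * y dvd v \<and> [b = a] (mod u) \<and> [b = 1] (mod 2 * y) \<and>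
    [s = x] (mod u) \<and> [t = k] (mod 2 * y))"
    (is "?L \<longleftrightarrow> ?R")
proof
  assume ?R
  then obtain x u v s t b where ky: "k \<le> y" and
    p: "pell_cond a x y" "pell_cond a u v" "pell_cond b s t" and
    v: "0 < v" "y * y dvd v" and b: "2 \<le> b" "[b = a] (mod u)" "[b = 1] (mod 2 * y)" and
    st: "[s = x] (mod u)" "[t = k] (mod 2 * y)" by blast
  obtain i n j where
    i: "int x = px (int a) i" "int y = py (int a) i" and
    n: "int u = px (int a) n" "int v = py (int a) n" and
    j: "int s = px (int b) j" "int t = py (int b) j"
    using p pell_cond_iff[OF a] pell_cond_iff[OF b(1)] by meson
  have a': "int a \<ge> 2" using a by simp
  have i0: "i > 0" using i ky k by (cases i) auto
  have n0: "n > 0" using n v by (cases n) auto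
  have "(py (int a) i)\<^sup>2 dvd py (int a) n"
    using v(2) by (simp flip: i n add: power2_eq_square) (simp only: flip: of_nat_mult int_dvd_int_iff)
  then have yn: "int y dvd int n" using py_dvd_index_if_sq_dvd[OF a' i0] i by simp
  have "py (int a) i dvd py (int a) n" using \<open>(py (int a) i)\<^sup>2 dvd py (int a) n\<close>
    by (metis dvd_trans dvd_triv_left power2_eq_square)
  then have "i \<le> n" using index_dvd_if_py_dvd[OF a' i0] n0 by (simp add: dvd_imp_le)
  have "[int b = int a] (mod px (int a) n)" using b(2) unfolding n(1)[symmetric] by (simp add: cong_int_iff)
  then have "[px (int b) j = px (int a) j] (mod px (int a) n)" using px_py_cong_base by blast
  moreover have "[px (int b) j = px (int a) i] (mod px (int a) n)"
    using st(1) unfolding n(1)[symmetric] j(1)[symmetric] i(1)[symmetric] by (simp add: cong_int_iff)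
  ultimately have "[px (int a) j = px (int a) i] (mod px (int a) n)" using cong_sym cong_trans by blast
  then have "2 * int n dvd int j - int i \<or> 2 * int n dvd int j + int i"
    using px_step_down[OF a' n0 \<open>i \<le> n\<close>] by (simp add: cong_iff_dvd_diff)
  moreover have "2 * int y dvd 2 * int n" using yn by simp
  ultimately have ji: "2 * int y dvd int j - int i \<or> 2 * int y dvd int j + int i"
    using dvd_trans by blast
  have "[int b = 1] (mod 2 * int y)" using b(3)
    by (metis cong_int_iff of_nat_1 of_nat_mult of_nat_numeral)
  then have "2 * int y dvd int b - 1" by (simp add: cong_iff_dvd_diff)
  moreover have "[int t = int j] (mod (int b - 1))" using px_py_cong_index j by auto
  ultimately have "[int t = int j] (mod 2 * int y)" using cong_dvd_modulus by blast
  moreover have "[int t = int k] (mod 2 * int y)" using st(2)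
    by (metis cong_int_iff of_nat_mult of_nat_numeral)
  ultimately have d: "2 * int y dvd int j - int k" using cong_sym cong_trans cong_iff_dvd_diff by blast
  from ji have "2 * int y dvd int k - int i \<or> 2 * int y dvd int k + int i"
  proof
    assume "2 * int y dvd int j - int i"
    then have "2 * int y dvd (int j - int i) - (int j - int k)" using d by (rule dvd_diff)
    then show ?thesis by simp
  next
    assume "2 * int y dvd int j + int i"
    then have "2 * int y dvd (int j + int i) - (int j - int k)" using d by (rule dvd_diff)
    then show ?thesis by (simp add: add.commute)
  qed
  moreover have "int i \<le> int y" using py_ge_index[OF a', of i] i by simp
  \<comment> \<open>Both \<open>k\<close> and \<open>i\<close> lie in \<open>1..y\<close>: their
    difference stays below \<open>2y\<close> in absolute value, and their sum reaches
    \<open>2y\<close> only if both equal \<open>y\<close>.\<close>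
  ultimately have "k = i"
  proof (elim disjE)
    assume d: "2 * int y dvd int k - int i"
    show "k = i"
    proof (rule ccontr)
      assume "k \<noteq> i"
      then have "\<bar>2 * int y\<bar> \<le> \<bar>int k - int i\<bar>" using d by (intro dvd_imp_le_int) auto
      then show False using ky k i0 \<open>int i \<le> int y\<close> by linarith
    qed
  next
    assume d: "2 * int y dvd int k + int i"
    then have "2 * int y \<le> int k + int i" using k by (intro zdvd_imp_le) auto
    then show "k = i" using ky \<open>int i \<le> int y\<close> by linarith
  qed
  then show ?L using i by simp
next
  assume L: ?L
  have a': "int a \<ge> 2" using a by simp
  have "k \<le> y" using py_ge_index[OF a', of k] L by simp
  \<comment> \<open>The factor \<open>y\<close> gives \<open>y * y dvd v\<close>. The factor 2 makes
    \<open>v\<close> even, so that \<open>u\<close> is coprime to \<open>2 * y\<close> and the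
    Chinese remainder theorem provides the base \<open>b\<close>.\<close>
  define m where "m = k * y * 2"
  have "m > 0" using k \<open>k \<le> y\<close> unfolding m_def by simp
  define x u v where "x = nat (px (int a) k)" and "u = nat (px (int a) m)" and "v = nat (py (int a) m)"
  have xuv: "int x = px (int a) k" "int u = px (int a) m" "int v = py (int a) m"
    using px_py_pos[OF a'] unfolding x_def u_def v_def by (simp_all add: less_imp_le)
  have "v > 0" using py_ge_index[OF a', of m] \<open>m > 0\<close> xuv by simp
  have "(py (int a) k)\<^sup>2 dvd py (int a) (k * y)" using py_sq_dvd[OF a', of k] L by (metis nat_int)
  also have "\<dots> dvd py (int a) m" unfolding m_def by (rule py_dvd_py_mult)
  finally have "int (y * y) dvd int v" using L xuv by (simp add: power2_eq_square)
  then have yv: "y * y dvd v" by (simp only: int_dvd_int_iff)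
  have "py (int a) m = 2 * (px (int a) (k * y) * py (int a) (k * y))"
    using py_add[of "int a" "k * y" "k * y"] unfolding m_def by (simp add: mult_2_right algebra_simps)
  then have "even v" using xuv(3) by (metis dvd_triv_left even_of_nat_iff)
  have "coprime u (2 * y)"
  proof -
    have cuv: "coprime u v" using coprime_px_py[of "int a" m] by (simp flip: xuv)
    have "coprime u 2" using coprime_divisors[OF dvd_refl \<open>even v\<close> cuv] .
    moreover have "y dvd v" using yv dvd_mult_left by blast
    then have "coprime u y" using coprime_divisors[OF dvd_refl _ cuv] by blast
    ultimately show ?thesis by simp
  qed
  then obtain b0 where b0: "[b0 = a] (mod u)" "[b0 = 1] (mod 2 * y)"
    using binary_chinese_remainder_nat by blast
  \<comment> \<open>A multiple of both moduli is added to ensure \<open>b >= 2\<close>.\<close>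
  define b where "b = b0 + 2 * (u * (2 * y))"
  have "u > 0" using px_py_pos[OF a', of m] xuv by simp
  moreover have "y > 0" using k \<open>k \<le> y\<close> by simp
  ultimately have "1 \<le> u * (2 * y)" by (simp add: Suc_le_eq)
  then have "b \<ge> 2" unfolding b_def by linarith
  have "b = b0 + u * (4 * y)" "b = b0 + (2 * y) * (2 * u)" unfolding b_def by (simp_all add: ac_simps)
  then have b: "[b = a] (mod u)" "[b = 1] (mod 2 * y)"
    using b0 unfolding cong_def by (metis mod_mult_self2)+
  define s t where "s = nat (px (int b) k)" and "t = nat (py (int b) k)"
  have st: "int s = px (int b) k" "int t = py (int b) k"
    using px_py_pos[of "int b" k] \<open>b \<ge> 2\<close> unfolding s_def t_def by simp_all
  have "[int b = int a] (mod int u)" using b(1) by (simp add: cong_int_iff)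
  then have "[s = x] (mod u)" using px_py_cong_base[of "int b" "int a" "int u" k] by (simp add: cong_int_iff flip: st xuv)
  have "[int b = 1] (mod int (2 * y))" using b(2) by (metis cong_int_iff of_nat_1)
  then have "int (2 * y) dvd int b - 1" by (simp only: cong_iff_dvd_diff)
  moreover have "[int t = int k] (mod (int b - 1))" using px_py_cong_index st by auto
  ultimately have "[int t = int k] (mod int (2 * y))" using cong_dvd_modulus by blast
  then have "[t = k] (mod 2 * y)" by (simp only: cong_int_iff)
  moreover have "pell_cond a x y" "pell_cond a u v" "pell_cond b s t"
    using pell_cond_iff[OF a] pell_cond_iff[OF \<open>b \<ge> 2\<close>] L xuv st by blast+
  ultimately show ?R
    using \<open>k \<le> y\<close> \<open>v > 0\<close> \<open>b \<ge> 2\<close> yv b \<open>[s = x] (mod u)\<close>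
    by (intro conjI exI[of _ x] exI[of _ u] exI[of _ v] exI[of _ s] exI[of _ t] exI[of _ b])
qed

section \<open>Powers, binomial coefficients and factorials\<close>

lemma dioph_pell_cond: "dfun f \<Longrightarrow> dfun g \<Longrightarrow> dfun h \<Longrightarrow> dioph (\<lambda>v. pell_cond (f v) (g v) (h v))"
  unfolding pell_cond_def by (intro dioph_arith_intros)

lemma dioph_py:
  assumes "dfun f" "dfun g" "dfun h"
  shows "dioph (\<lambda>v. 2 \<le> g v \<and> int (f v) = py (int (g v)) (h v))"
proof -
  let ?R = "\<lambda>y a k. 2 \<le> a \<and> (k = 0 \<and> y = 0 \<or> 1 \<le> k \<and> k \<le> y \<and> (\<exists>x u v s t b. pell_cond a x y \<and> pell_cond a u v \<and>
    pell_cond b s t \<and> 0 < v \<and> 2 \<le> b \<and> y * y dvd v \<and> [b = a] (mod u) \<and> [b = 1] (mod 2 * y) \<and>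
    [s = x] (mod u) \<and> [t = k] (mod 2 * y)))"
  have "dioph (\<lambda>v. ?R (f v) (g v) (h v))"
    by (rule dioph_apply3[where R = ?R, OF _ assms]) (intro dioph_pell_cond dioph_arith_intros)
  moreover have "?R y a k \<longleftrightarrow> 2 \<le> a \<and> int y = py (int a) k" for y a k :: nat
  proof (cases "k = 0 \<or> \<not> 2 \<le> a")
    case False
    then have "2 \<le> a" "1 \<le> k" by auto
    show ?thesis
      unfolding py_characterization[OF \<open>2 \<le> a\<close> \<open>1 \<le> k\<close>] using \<open>1 \<le> k\<close> by simp
  qed auto
  ultimately show ?thesis by simp
qed

text \<open>By \<open>py_ge_power\<close>, \<open>q\<close> is at least \<open>k^n\<close>. The base
  \<open>a = q + k + 2\<close> makes the modulus of \<open>px_py_power\<close> exceed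
  \<open>q\<close>, so the congruence and \<open>z <= q\<close> determine \<open>z\<close>. The
  coefficient \<open>q + 2\<close> is \<open>a - k\<close>, moved across to avoid a
  subtraction.\<close>

lemma power_characterization:
  fixes z k n :: nat
  assumes k: "k \<ge> 1"
  shows "z = k ^ n \<longleftrightarrow> (\<exists>q x y. int q = py (int (k + 2)) (Suc n) \<and>
    int y = py (int (q + k + 2)) n \<and> pell_cond (q + k + 2) x y \<and>
    z < q + 1 \<and> [z + (q + 2) * y = x] (mod (2 * (q + k + 2) * k - k * k - 1)))"
    (is "_ \<longleftrightarrow> ?R")
proof -
  have pos: "px (int a) m > 0" "py (int a) m \<ge> 0" if "a \<ge> 2" for a m
    using px_py_pos[of "int a" m] that by auto
  define q where "q = nat (py (int (k + 2)) (Suc n))"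
  define a where "a = q + k + 2"
  define x y where "x = nat (px (int a) n)" and "y = nat (py (int a) n)"
  have q: "int q = py (int (k + 2)) (Suc n)"
    using pos(2)[of "k + 2" "Suc n"] unfolding q_def by (simp del: py.simps)
  have "int (k ^ n) \<le> int (k + 2) ^ n" by (simp add: power_mono)
  also have "\<dots> \<le> int q" unfolding q using py_ge_power[of "int (k + 2)" n] by simp
  finally have kq: "k ^ n \<le> q" by simp
  have xy: "int x = px (int a) n" "int y = py (int a) n"
    using pos[of a n] unfolding x_def y_def a_def by auto
  have a2: "a \<ge> 2" unfolding a_def by simp
  have m: "int (2 * a * k - k * k - 1) = 2 * int a * int k - (int k)\<^sup>2 - 1"
    and mq: "q < 2 * a * k - k * k - 1"
  proof -
    have "q \<le> q * k" using k by simp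
    moreover have "2 * a * k = 2 * (q * k) + 2 * (k * k) + 4 * k"
      unfolding a_def by (simp add: algebra_simps)
    ultimately have "q + (k * k + 2) \<le> 2 * a * k - k * k" "k * k + 1 \<le> 2 * a * k"
      using k by linarith+
    then show "q < 2 * a * k - k * k - 1" by linarith
    have "1 + k * k \<le> 2 * a * k" using \<open>k * k + 1 \<le> 2 * a * k\<close> by simp
    then show "int (2 * a * k - k * k - 1) = 2 * int a * int k - (int k)\<^sup>2 - 1"
      by (simp add: of_nat_diff power2_eq_square)
  qed
  have "[int x - (int a - int k) * int y = int k ^ n] (mod (2 * int a * int k - (int k)\<^sup>2 - 1))"
    using px_py_power[of "int a" "int k" n] unfolding xy by (simp add: cong_iff_dvd_diff)
  then have "[(int x - (int a - int k) * int y) + (int q + 2) * int y = int k ^ n + (int q + 2) * int y]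
      (mod (2 * int a * int k - (int k)\<^sup>2 - 1))"
    by (rule cong_add) simp
  moreover have "(int x - (int a - int k) * int y) + (int q + 2) * int y = int x"
    unfolding a_def by (simp add: algebra_simps)
  ultimately have "[int x = int (k ^ n + (q + 2) * y)] (mod int (2 * a * k - k * k - 1))"
    by (simp only: m of_nat_add of_nat_mult of_nat_power of_nat_numeral)
  then have cong: "[k ^ n + (q + 2) * y = x] (mod (2 * a * k - k * k - 1))"
    by (simp only: cong_int_iff cong_sym_eq)
  have pc: "pell_cond a x y" using pell_cond_iff[OF a2] xy by blast
  show ?thesis
  proof
    assume "z = k ^ n"
    then show ?R using q xy pc cong kq unfolding a_def by (intro exI[of _ q] exI[of _ x] exI[of _ y]) auto
  next
    assume ?R
    then obtain q' x' y' where 1: "int q' = py (int (k + 2)) (Suc n)"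
      "int y' = py (int (q' + k + 2)) n" "pell_cond (q' + k + 2) x' y'"
      "z < q' + 1" "[z + (q' + 2) * y' = x'] (mod (2 * (q' + k + 2) * k - k * k - 1))" by blast
    have "q' = q" using 1(1) q by (metis of_nat_eq_iff)
    then have "y' = y" using 1(2) xy unfolding a_def by (metis of_nat_eq_iff)
    have "x' * x' = x * x" using 1(3) pc \<open>q' = q\<close> \<open>y' = y\<close> unfolding pell_cond_def a_def by simp
    then have "x' = x" by (simp flip: power2_eq_square)
    then have "[z + (q + 2) * y = k ^ n + (q + 2) * y] (mod (2 * a * k - k * k - 1))"
      using 1(5) cong \<open>q' = q\<close> \<open>y' = y\<close> unfolding a_def using cong_sym cong_trans by blast
    then have "[z = k ^ n] (mod (2 * a * k - k * k - 1))" by (simp add: cong_add_rcancel_nat)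
    then show "z = k ^ n" using 1(4) \<open>q' = q\<close> mq kq unfolding cong_def by simp
  qed
qed

lemma dfun_power:
  assumes "dfun f" "dfun g"
  shows "dfun (\<lambda>v. f v ^ g v)"
proof (rule dfun_apply2[where F = "(^)", OF _ assms])
  \<comment> \<open>The trivial bounds \<open>2 <= k + 2\<close> and \<open>2 <= q + k + 2\<close>
    give the conjuncts the shape of \<open>dioph_py\<close>. Base 0 is treated separately because
    \<open>power_characterization\<close> requires \<open>k >= 1\<close>.\<close>
  let ?R = "\<lambda>z k n. (k = 0 \<and> n = 0 \<and> z = 1) \<or> (k = 0 \<and> 1 \<le> n \<and> z = 0) \<or> (1 \<le> k \<and> (\<exists>q x y.
    (2 \<le> k + 2 \<and> int q = py (int (k + 2)) (Suc n)) \<and>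
    (2 \<le> q + k + 2 \<and> int y = py (int (q + k + 2)) n) \<and> pell_cond (q + k + 2) x y \<and>
    z < q + 1 \<and> [z + (q + 2) * y = x] (mod (2 * (q + k + 2) * k - k * k - 1))))"
  have "dioph (\<lambda>v. ?R (v 0) (v 1) (v 2))"
    by (intro dioph_ex dioph_disj dioph_conj[of "\<lambda>v. v a = 0" for a]
      dioph_conj[of "\<lambda>v. 1 \<le> v a" for a]
      dioph_conj[of "\<lambda>v. 2 \<le> f v \<and> int (g v) = py (int (f v)) (h v)" for f g h]
      dioph_conj[of "\<lambda>v. pell_cond (f v) (g v) (h v)" for f g h]
      dioph_conj[of "\<lambda>v. f v < g v" for f g]
      dioph_py dioph_pell_cond dioph_arith_intros)
  moreover have "?R z k n \<longleftrightarrow> z = k ^ n" for z k n :: nat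
  proof (cases "k = 0")
    case False
    then show ?thesis using power_characterization[of k z n] by (simp del: py.simps)
  qed (auto simp: power_0_left)
  ultimately show "dioph (\<lambda>v. v 0 = v 1 ^ v 2)" by simp
qed

text \<open>The coefficients of \<open>(u + 1)^n\<close> are at most \<open>2^n < u\<close>, so no
  carries occur and they are its digits in base \<open>u\<close>.\<close>

lemma binomial_digit:
  fixes n k u :: nat
  assumes "2 ^ n < u"
  shows "(n choose k) = (u + 1) ^ n div u ^ k mod u"
proof (cases "k \<le> n")
  case False
  have "u > 0" using assms by simp
  have "(u + 1) ^ n = (\<Sum>i\<le>n. (n choose i) * u ^ i)"
    using binomial[of u 1 n] by simp
  also have "\<dots> < u ^ Suc n"
  proof -
    have "(\<Sum>i\<le>n. (n choose i) * u ^ i) \<le> (\<Sum>i\<le>n. (n choose i) * u ^ n)"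
      using \<open>u > 0\<close> by (intro sum_mono mult_le_mono2 power_increasing) auto
    also have "\<dots> = 2 ^ n * u ^ n" by (simp add: choose_row_sum flip: sum_distrib_right)
    also have "\<dots> < u * u ^ n" using assms \<open>u > 0\<close> by simp
    finally show ?thesis by simp
  qed
  also have "\<dots> \<le> u ^ k" using False \<open>u > 0\<close> by (intro power_increasing) auto
  finally have "(u + 1) ^ n div u ^ k = 0" by simp
  then show ?thesis using False by simp
next
  case True
  have "u > 0" using assms by simp
  have row: "(\<Sum>i\<in>A. n choose i) \<le> 2 ^ n" if "A \<subseteq> {..n}" for A
    using sum_mono2[of "{..n}" A "\<lambda>i. n choose i"] that choose_row_sum[of n] by simp
  have lt: "(\<Sum>i<k. (n choose i) * u ^ i) < u ^ k"
  proof (cases k)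
    case (Suc l)
    have "(\<Sum>i<k. (n choose i) * u ^ i) \<le> (\<Sum>i<k. (n choose i) * u ^ l)"
      using \<open>u > 0\<close> Suc by (intro sum_mono mult_le_mono2 power_increasing) auto
    also have "\<dots> \<le> 2 ^ n * u ^ l"
      using row[of "{..<k}"] True by (simp add: subset_eq flip: sum_distrib_right)
    also have "\<dots> < u * u ^ l" using assms \<open>u > 0\<close> by simp
    finally show ?thesis using Suc by simp
  qed simp
  have "(u + 1) ^ n = (\<Sum>i\<le>n. (n choose i) * u ^ i)"
    using binomial[of u 1 n] by simp
  also have "{..n} = {..<k} \<union> {k..n}" using True by auto
  also have "(\<Sum>i\<in>{..<k} \<union> {k..n}. (n choose i) * u ^ i)
      = (\<Sum>i<k. (n choose i) * u ^ i) + (\<Sum>i\<in>{k..n}. (n choose i) * u ^ i)"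
    by (rule sum.union_disjoint) auto
  also have "{k..n} = insert k {Suc k..n}" using True by auto
  also have "(\<Sum>i\<in>insert k {Suc k..n}. (n choose i) * u ^ i)
      = (n choose k) * u ^ k + (\<Sum>i\<in>{Suc k..n}. (n choose i) * u ^ i)"
    by simp
  also have "(\<Sum>i\<in>{Suc k..n}. (n choose i) * u ^ i)
      = u ^ k * (u * (\<Sum>i\<in>{Suc k..n}. (n choose i) * u ^ (i - Suc k)))"
    unfolding sum_distrib_left
  proof (rule sum.cong)
    fix i assume "i \<in> {Suc k..n}"
    then have "u ^ i = u ^ (k + 1 + (i - Suc k))" by simp
    then have "u ^ i = u ^ k * u * u ^ (i - Suc k)" by (simp only: power_add power_one_right)
    then show "(n choose i) * u ^ i = u ^ k * (u * ((n choose i) * u ^ (i - Suc k)))" by simp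
  qed simp
  finally have "(u + 1) ^ n = (\<Sum>i<k. (n choose i) * u ^ i)
      + u ^ k * ((n choose k) + u * (\<Sum>i\<in>{Suc k..n}. (n choose i) * u ^ (i - Suc k)))"
    by (simp add: algebra_simps)
  then have "(u + 1) ^ n div u ^ k
      = (n choose k) + u * (\<Sum>i\<in>{Suc k..n}. (n choose i) * u ^ (i - Suc k))"
    using div_mult_self2[of "u ^ k"] lt \<open>u > 0\<close> by simp
  moreover have "(n choose k) < u"
    using row[of "{k}"] True assms by simp
  ultimately show ?thesis by simp
qed

lemma dfun_choose:
  assumes "dfun f" "dfun g"
  shows "dfun (\<lambda>v. f v choose g v)"
proof -
  have "dfun (\<lambda>v. (2 ^ f v + 1 + 1) ^ f v div (2 ^ f v + 1) ^ g v mod (2 ^ f v + 1))"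
    by (intro dioph_arith_intros dfun_power assms)
  then show ?thesis
    using binomial_digit[of n "2 ^ n + 1" for n] by simp
qed

lemma Suc_times_choose_Suc: "Suc k * (n choose Suc k) = (n - k) * (n choose k)"
  by (simp only: binomial_absorption binomial_absorb_comp)

text \<open>Also true for \<open>k > n\<close>: the factor with \<open>i = n\<close> is then 0, as
  is the binomial coefficient.\<close>

lemma fact_times_choose: "fact k * (n choose k) = (\<Prod>i<k. n - i)"
proof (induction k)
  case (Suc k)
  have "fact (Suc k) * (n choose Suc k) = fact k * (Suc k * (n choose Suc k))"
    by (simp only: fact_Suc of_nat_id mult.assoc mult.left_commute)
  also have "\<dots> = (fact k * (n choose k)) * (n - k)"
    by (simp only: Suc_times_choose_Suc mult.assoc mult.commute mult.left_commute)
  finally show ?case using Suc by simp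
qed simp

text \<open>The quotient of \<open>r^n\<close> by \<open>r choose n\<close> is \<open>n!\<close>
  times \<open>r^n / (r (r - 1) ... (r - n + 1))\<close>, which tends to \<open>n!\<close> from
  above as \<open>r\<close> grows. With \<open>n! <= n^n\<close>, the bound on \<open>r\<close>
  keeps the error below 1.\<close>

lemma fact_eq_div_choose:
  fixes n r :: nat
  assumes "n \<ge> 1" "n ^ n * n ^ 2 + n ^ 2 < r"
  shows "fact n = r ^ n div (r choose n)"
proof -
  have "n ^ 2 < r" using assms(2) by simp
  moreover have "n \<le> n * n" by simp
  ultimately have nr: "n \<le> r" unfolding power2_eq_square by linarith
  define P where "P = fact n * (r choose n)"
  have P: "P = (\<Prod>i<n. r - i)"
    unfolding P_def by (rule fact_times_choose)
  have Ple: "P \<le> r ^ n"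
    unfolding P using prod_mono[of "{..<n}" "\<lambda>i. r - i" "\<lambda>i. r"] by simp
  \<comment> \<open>A Bernoulli-type estimate: replacing one factor \<open>r - i\<close> by
    \<open>r\<close> costs at most \<open>n * r^(m - 1)\<close>.\<close>
  have bern: "r ^ m \<le> (\<Prod>i<m. r - i) + m * n * r ^ (m - 1)" if "m \<le> n" for m
    using that
  proof (induction m)
    case (Suc m)
    have "r ^ Suc m = r ^ m * (r - m) + r ^ m * m"
      using Suc(2) nr by (metis Suc_leD add_mult_distrib2 le_add_diff_inverse2 le_trans power_Suc2)
    also have "\<dots> \<le> ((\<Prod>i<m. r - i) + m * n * r ^ (m - 1)) * (r - m) + r ^ m * n"
      using Suc by (intro add_mono mult_le_mono) auto
    also have "\<dots> = (\<Prod>i<Suc m. r - i) + m * n * (r ^ (m - 1) * (r - m)) + r ^ m * n"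
      by (simp add: algebra_simps)
    also have "m * n * (r ^ (m - 1) * (r - m)) \<le> m * n * r ^ m"
      by (cases m) (auto simp: mult_le_mono)
    finally show ?case by (simp add: algebra_simps)
  qed simp
  define T where "T = r ^ (n - 1)"
  have rn: "r ^ n = r * T" using assms(1) unfolding T_def by (cases n) auto
  have "T > 0" using nr assms(1) unfolding T_def by simp
  have F: "(fact n :: nat) \<le> n ^ n" using fact_le_power[where 'a = nat, of n] by simp
  have "r * T \<le> P + n\<^sup>2 * T" using bern[of n] unfolding P[symmetric] rn T_def[symmetric]
    by (simp add: power2_eq_square)
  moreover have "(fact n * n\<^sup>2 + n\<^sup>2) * T < r * T"
  proof -
    have "fact n * n\<^sup>2 \<le> n ^ n * n\<^sup>2" using F by (rule mult_le_mono1)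
    then have "fact n * n\<^sup>2 + n\<^sup>2 < r" using assms(2) by linarith
    then show ?thesis using \<open>T > 0\<close> by (rule mult_strict_right_mono)
  qed
  ultimately have 1: "fact n * (n\<^sup>2 * T) < P" and 2: "r * T \<le> P + n\<^sup>2 * T"
    by (auto simp: algebra_simps)
  have "fact n * (r ^ n) \<le> fact n * P + fact n * (n\<^sup>2 * T)"
    using 2 unfolding rn by (metis add_mult_distrib2 mult_le_mono2)
  also have "\<dots> < fact n * P + P" using 1 by simp
  finally have "fact n * r ^ n < fact n * ((fact n + 1) * (r choose n))"
    unfolding P_def by (simp add: algebra_simps)
  then have "r ^ n < (fact n + 1) * (r choose n)" by simp
  moreover have "(r choose n) * fact n \<le> r ^ n" using Ple unfolding P_def by (simp add: mult.commute)
  ultimately show ?thesis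
    by (intro div_nat_eqI[symmetric]) (auto simp: mult.commute)
qed

lemma dfun_fact:
  assumes "dfun f"
  shows "dfun (\<lambda>v. fact (f v))"
proof (rule dfun_apply1[where F = fact, OF _ assms])
  let ?r = "\<lambda>n. n ^ n * n ^ 2 + n ^ 2 + 1 :: nat"
  have "dioph (\<lambda>v. (v 1 = 0 \<and> v 0 = 1) \<or> (1 \<le> v 1 \<and> v 0 = ?r (v 1) ^ v 1 div (?r (v 1) choose v 1)))"
    by (intro dioph_arith_intros dfun_power dfun_choose)
  moreover have "((n = 0 \<and> z = 1) \<or> (1 \<le> n \<and> z = ?r n ^ n div (?r n choose n))) \<longleftrightarrow> z = fact n"
    for n z :: nat
    using fact_eq_div_choose[of n "?r n"] by (cases "n = 0") auto
  ultimately show "dioph (\<lambda>v. v 0 = fact (v 1))" by simp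
qed

lemmas dioph_fun_intros = dioph_arith_intros dfun_power dfun_choose dfun_fact

section \<open>Bounded universal quantification\<close>

fun cstr_cong :: "nat \<Rightarrow> ('a \<Rightarrow> nat) \<Rightarrow> 'a cstr \<Rightarrow> bool" where
  "cstr_cong m \<rho> (Const_eq a c) \<longleftrightarrow> [\<rho> a = c] (mod m)"
| "cstr_cong m \<rho> (Add_eq a b c) \<longleftrightarrow> [\<rho> a = \<rho> b + \<rho> c] (mod m)"
| "cstr_cong m \<rho> (Mult_eq a b c) \<longleftrightarrow> [\<rho> a = \<rho> b * \<rho> c] (mod m)"

fun cstr_const :: "'a cstr \<Rightarrow> nat" where
  "cstr_const (Const_eq a c) = c"
| "cstr_const _ = 0"

lemma cstr_cong_cong:
  assumes "\<And>i. i \<in> set_cstr c \<Longrightarrow> [\<rho> i = \<rho>' i] (mod m)"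
  shows "cstr_cong m \<rho> c \<longleftrightarrow> cstr_cong m \<rho>' c"
proof (cases c)
  case (Const_eq a k)
  then have "[\<rho> a = \<rho>' a] (mod m)" using assms by simp
  then show ?thesis using Const_eq by (simp add: cong_def)
next
  case (Add_eq a b d)
  then have "[\<rho> a = \<rho>' a] (mod m)" "[\<rho> b + \<rho> d = \<rho>' b + \<rho>' d] (mod m)"
    using assms by (auto intro: cong_add)
  then show ?thesis using Add_eq by (simp add: cong_def)
next
  case (Mult_eq a b d)
  then have "[\<rho> a = \<rho>' a] (mod m)" "[\<rho> b * \<rho> d = \<rho>' b * \<rho>' d] (mod m)"
    using assms by (auto intro: cong_mult)
  then show ?thesis using Mult_eq by (simp add: cong_def)
qed

lemma cstr_cong_if_holds: "holds \<rho> c \<Longrightarrow> cstr_cong m \<rho> c"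
  by (cases c) auto

lemma cstr_cong_dvd: "cstr_cong m \<rho> c \<Longrightarrow> p dvd m \<Longrightarrow> cstr_cong p \<rho> c"
  by (cases c) (auto intro: cong_dvd_modulus_nat)

lemma cstr_cong_prod:
  assumes "finite A" "\<And>x y. x \<in> A \<Longrightarrow> y \<in> A \<Longrightarrow> x \<noteq> y \<Longrightarrow> coprime (m x) (m y)"
    "\<And>x. x \<in> A \<Longrightarrow> cstr_cong (m x) \<rho> c"
  shows "cstr_cong (\<Prod>x\<in>A. m x) \<rho> c"
  using assms by (cases c) (auto intro!: coprime_cong_prod_nat)

text \<open>Both sides of any constraint are at most \<open>U * U + 2 * U\<close>, so congruence
  modulo the larger \<open>p\<close> is equality.\<close>

lemma holds_if_cstr_cong:
  assumes "cstr_cong p \<rho> c" "\<And>i. i \<in> set_cstr c \<Longrightarrow> \<rho> i \<le> U" "cstr_const c \<le> U"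
    "U * U + 2 * U < p"
  shows "holds \<rho> c"
proof -
  have eq: "x = y" if "[x = y] (mod p)" "x \<le> U * U + 2 * U" "y \<le> U * U + 2 * U" for x y
    using that assms(4) by (simp add: cong_def)
  show ?thesis
  proof (cases c)
    case (Const_eq a k)
    then show ?thesis using assms(1,2,3) eq[of "\<rho> a" k] by simp
  next
    case (Add_eq a b d)
    then have "\<rho> a \<le> U" "\<rho> b \<le> U" "\<rho> d \<le> U" using assms(2) by auto
    then show ?thesis using Add_eq assms(1) eq[of "\<rho> a" "\<rho> b + \<rho> d"] by simp
  next
    case (Mult_eq a b d)
    then have "\<rho> a \<le> U" "\<rho> b \<le> U" "\<rho> d \<le> U" using assms(2) by auto
    moreover from this have "\<rho> b * \<rho> d \<le> U * U" by (intro mult_le_mono)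
    ultimately show ?thesis using Mult_eq assms(1) eq[of "\<rho> a" "\<rho> b * \<rho> d"] by simp
  qed
qed

text \<open>With \<open>N = (Q!)^2 - 1\<close> this is \<open>(N - x) / (x + 1)\<close>, the factor
  by which \<open>N choose x\<close> grows to \<open>N choose (x + 1)\<close>; hence the product of
  the moduli is a binomial coefficient. The factorial is squared so that the quotient by
  \<open>x + 1\<close> remains divisible by \<open>Q!\<close>, which makes every prime factor of the
  modulus exceed \<open>Q\<close>.\<close>

definition modulus :: "nat \<Rightarrow> nat \<Rightarrow> nat" where
  "modulus Q x = (fact Q)\<^sup>2 div Suc x - 1"

lemma Suc_modulus:
  assumes "x < Q"
  shows "Suc (modulus Q x) = fact Q * (fact Q div Suc x)"
    and "(fact Q)\<^sup>2 = Suc x * Suc (modulus Q x)"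
proof -
  have d: "Suc x dvd fact Q" using assms by (intro dvd_fact) auto
  have *: "(fact Q)\<^sup>2 div Suc x = fact Q * (fact Q div Suc x)"
    unfolding power2_eq_square by (rule div_mult_swap[OF d, symmetric])
  have "Suc x \<le> fact Q" using d by (intro dvd_imp_le) auto
  then have "fact Q div Suc x > 0" by (simp add: div_greater_zero_iff)
  then have "fact Q * (fact Q div Suc x) > 0" by simp
  then show 1: "Suc (modulus Q x) = fact Q * (fact Q div Suc x)"
    unfolding modulus_def * by linarith
  show "(fact Q)\<^sup>2 = Suc x * Suc (modulus Q x)"
    unfolding 1 using d by (simp only: mult.left_commute[of "Suc x"] dvd_mult_div_cancel power2_eq_square)
qed

lemma prime_dvd_modulus:
  assumes "prime p" "p dvd modulus Q x" "x < Q"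
  shows "Q < p"
proof (rule ccontr)
  assume "\<not> Q < p"
  then have "p dvd fact Q" using assms(1) by (simp add: prime_dvd_fact_iff)
  then have "p dvd Suc (modulus Q x)" unfolding Suc_modulus(1)[OF assms(3)] by (rule dvd_mult2)
  then have "p dvd 1" using assms(2) by (metis Suc_eq_plus1 dvd_add_right_iff)
  then show False using assms(1) by simp
qed

lemma not_coprime_prime_nat:
  fixes a b :: nat
  assumes "\<not> coprime a b"
  obtains p where "prime p" "p dvd a" "p dvd b"
proof -
  have "gcd a b \<noteq> 1" using assms by (simp add: coprime_iff_gcd_eq_1)
  then obtain p where "prime p" "p dvd gcd a b" using prime_factor_nat by blast
  then show ?thesis using that by simp
qed

lemma coprime_modulus_fact:
  assumes "x < Q" "k \<le> Q"
  shows "coprime (modulus Q x) (fact k)"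
proof (rule ccontr)
  assume "\<not> coprime (modulus Q x) (fact k)"
  then obtain p where p: "prime p" "p dvd modulus Q x" "p dvd fact k"
    using not_coprime_prime_nat by blast
  then have "p \<le> k" by (simp add: prime_dvd_fact_iff)
  then show False using prime_dvd_modulus[OF p(1,2) assms(1)] assms(2) by simp
qed

text \<open>By \<open>Suc_modulus\<close> a common prime factor divides the difference of the two
  indices, which is below \<open>Q\<close>, while the prime itself exceeds \<open>Q\<close>.\<close>

lemma coprime_modulus:
  assumes "x < Q" "y < Q" "x \<noteq> y"
  shows "coprime (modulus Q x) (modulus Q y)"
proof -
  have "coprime (modulus Q x) (modulus Q y)" if "x < y" "y < Q" for x y
  proof (rule ccontr)
    assume "\<not> coprime (modulus Q x) (modulus Q y)"
    then obtain p where p: "prime p" "p dvd modulus Q x" "p dvd modulus Q y"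
      using not_coprime_prime_nat by blast
    have "Suc x * Suc (modulus Q x) = Suc y * Suc (modulus Q y)"
      using Suc_modulus(2)[of x Q] Suc_modulus(2)[of y Q] that by linarith
    then have "y - x = Suc x * modulus Q x - Suc y * modulus Q y"
      using that(1) by (simp add: algebra_simps)
    then have "p dvd y - x" using p by (simp add: dvd_diff_nat)
    then have "p \<le> y - x" using that by (intro dvd_imp_le) auto
    then show False using prime_dvd_modulus[OF p(1,3) that(2)] that by simp
  qed
  then show ?thesis using assms by (metis coprime_commute linorder_neqE_nat)
qed

lemma choose_eq_prod_modulus: "n \<le> Q \<Longrightarrow> ((fact Q)\<^sup>2 - 1) choose n = (\<Prod>x<n. modulus Q x)"
proof (induction n)
  case (Suc n)
  have "(fact Q)\<^sup>2 - 1 - n = Suc n * modulus Q n"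
    using Suc_modulus(2)[of n Q] Suc.prems by simp
  then have "Suc n * (((fact Q)\<^sup>2 - 1) choose Suc n) = Suc n * (modulus Q n * (((fact Q)\<^sup>2 - 1) choose n))"
    by (simp only: Suc_times_choose_Suc mult.assoc)
  then have "((fact Q)\<^sup>2 - 1) choose Suc n = modulus Q n * (((fact Q)\<^sup>2 - 1) choose n)"
    by (simp only: mult_cancel1) simp
  then show ?case using Suc by simp
qed simp

lemma modulus_cong: "x < Q \<Longrightarrow> [(fact Q)\<^sup>2 - 1 = x] (mod modulus Q x)"
proof -
  assume "x < Q"
  then have "(fact Q)\<^sup>2 - 1 = x + modulus Q x * Suc x"
    using Suc_modulus(2)[of x Q] by simp
  then show ?thesis by (simp only: cong_def mod_mult_self2)
qed

text \<open>The argument of the factorial is the \<open>Q\<close> of \<open>modulus\<close>. It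
  exceeds the bound of \<open>holds_if_cstr_cong\<close>, and the summand 3 keeps every modulus
  different from 1, so that it has a prime factor.\<close>

definition bforall_body ::
  "(nat + nat) cstr list \<Rightarrow> nat \<Rightarrow> nat \<Rightarrow> nat \<Rightarrow> (nat \<Rightarrow> nat) \<Rightarrow> nat \<Rightarrow> (nat \<Rightarrow> nat) \<Rightarrow> bool"
where
  "bforall_body cs m C n v U a \<longleftrightarrow> n \<le> U \<and> C \<le> U \<and> (\<forall>j<m. v j \<le> U) \<and>
    (\<forall>j<m. ((fact (U * U + 2 * U + 3))\<^sup>2 - 1) choose n dvd (a j choose Suc U)) \<and>
    (\<forall>c\<in>set cs. cstr_cong (((fact (U * U + 2 * U + 3))\<^sup>2 - 1) choose n)
      (case_sum a (case_nat ((fact (U * U + 2 * U + 3))\<^sup>2 - 1) v)) c)"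

text \<open>The number \<open>a j\<close> codes the witnesses \<open>w j\<close> for all \<open>x < n\<close> by their residues modulo the
  pairwise coprime moduli, whose product is a binomial coefficient. Modulo the \<open>x\<close>-th of them
  \<open>(Q!)\<^sup>2 - 1\<close> is congruent to \<open>x\<close>, so it stands for the bounded variable. Divisibility of
  \<open>a j choose Suc U\<close> forces \<open>a j\<close> to have a residue \<open>\<le> U\<close> modulo every prime factor of a modulus.\<close>

lemma bounded_forall_iff:
  fixes n m C :: nat and v :: "nat \<Rightarrow> nat"
  assumes Inl_less: "\<And>c j. c \<in> set cs \<Longrightarrow> Inl j \<in> set_cstr c \<Longrightarrow> j < m"
    and Inr_less: "\<And>c j. c \<in> set cs \<Longrightarrow> Inr (Suc j) \<in> set_cstr c \<Longrightarrow> j < m"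
    and const_le: "\<And>c. c \<in> set cs \<Longrightarrow> cstr_const c \<le> C"
  shows "(\<forall>x<n. \<exists>w. \<forall>c\<in>set cs. holds (case_sum w (case_nat x v)) c) \<longleftrightarrow>
    (\<exists>U a. bforall_body cs m C n v U a)"
proof
  assume "\<forall>x<n. \<exists>w. \<forall>c\<in>set cs. holds (case_sum w (case_nat x v)) c"
  then obtain W where W: "\<And>x. x < n \<Longrightarrow> \<forall>c\<in>set cs. holds (case_sum (W x) (case_nat x v)) c"
    by metis
  define U where "U = n + C + (\<Sum>j<m. v j) + (\<Sum>x<n. \<Sum>j<m. W x j)"
  define Q where "Q = U * U + 2 * U + 3"
  have vU: "v j \<le> U" if "j < m" for j
    using member_le_sum[of j "{..<m}" v] that unfolding U_def by simp
  have WU: "W x j \<le> U" if "x < n" "j < m" for x j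
  proof -
    have "W x j \<le> (\<Sum>j<m. W x j)" using that by (intro member_le_sum) auto
    also have "\<dots> \<le> (\<Sum>x<n. \<Sum>j<m. W x j)"
      using that by (intro member_le_sum[of x "{..<n}" "\<lambda>x. \<Sum>j<m. W x j"]) auto
    finally show ?thesis unfolding U_def by simp
  qed
  have nQ: "n \<le> Q" and UQ: "Suc U \<le> Q" unfolding Q_def U_def by auto
  have "\<exists>a. \<forall>x\<in>{..<n}. [a = W x j] (mod modulus Q x)" for j
    using nQ by (intro chinese_remainder_nat) (auto intro!: coprime_modulus)
  then obtain a where a: "\<And>j x. x < n \<Longrightarrow> [a j = W x j] (mod modulus Q x)"
    by (metis lessThan_iff)
  have M: "((fact Q)\<^sup>2 - 1) choose n = (\<Prod>x<n. modulus Q x)"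
    by (rule choose_eq_prod_modulus[OF nQ])
  have cop: "coprime (modulus Q x) (modulus Q y)" if "x < n" "y < n" "x \<noteq> y" for x y
    using that nQ by (intro coprime_modulus) auto
  have "modulus Q x dvd (a j choose Suc U)" if "x < n" "j < m" for x j
  \<comment> \<open>For \<open>a j <= U\<close> the binomial coefficient is 0. Otherwise
    \<open>W x j <= U\<close> makes \<open>a j - W x j\<close> one of the factors of the falling
    factorial.\<close>
  proof (cases "a j \<le> U")
    case False
    have "W x j \<le> a j" using WU[OF that] False by simp
    then have "modulus Q x dvd a j - W x j"
      using a[OF that(1), of j] by (simp add: cong_altdef_nat)
    also have "\<dots> dvd (\<Prod>i<Suc U. a j - i)"
      using WU[OF that] by (intro dvd_prodI[of "{..<Suc U}" "W x j" "\<lambda>i. a j - i"]) auto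
    also have "\<dots> = fact (Suc U) * (a j choose Suc U)" by (rule fact_times_choose[symmetric])
    finally have "modulus Q x dvd fact (Suc U) * (a j choose Suc U)" .
    moreover have "coprime (modulus Q x) (fact (Suc U))"
      using that nQ UQ by (intro coprime_modulus_fact) auto
    ultimately show ?thesis using coprime_dvd_mult_right_iff by blast
  qed (simp add: binomial_eq_0)
  then have "[(a j choose Suc U) = 0] (mod (\<Prod>x<n. modulus Q x))" if "j < m" for j
    using that cop by (intro coprime_cong_prod_nat) (auto simp: cong_0_iff)
  then have dvd: "((fact Q)\<^sup>2 - 1) choose n dvd (a j choose Suc U)" if "j < m" for j
    unfolding M using that by (simp add: cong_0_iff)
  have cc: "cstr_cong (((fact Q)\<^sup>2 - 1) choose n) (case_sum a (case_nat ((fact Q)\<^sup>2 - 1) v)) c"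
    if "c \<in> set cs" for c
    unfolding M
  proof (rule cstr_cong_prod)
    fix x assume "x \<in> {..<n}"
    then have x: "x < n" by simp
    have c0: "cstr_cong (modulus Q x) (case_sum (W x) (case_nat x v)) c"
      using W[OF x] that by (blast intro: cstr_cong_if_holds)
    have cg: "[case_sum a (case_nat ((fact Q)\<^sup>2 - 1) v) i = case_sum (W x) (case_nat x v) i]
        (mod modulus Q x)" for i
      using a[OF x] modulus_cong[of x Q] x nQ by (auto split: sum.split nat.split)
    show "cstr_cong (modulus Q x) (case_sum a (case_nat ((fact Q)\<^sup>2 - 1) v)) c"
      by (rule iffD2[OF cstr_cong_cong c0]) (rule cg)
  qed (use cop in auto)
  have "n \<le> U" "C \<le> U" unfolding U_def by auto
  then have "bforall_body cs m C n v U a"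
    unfolding bforall_body_def using vU dvd cc unfolding Q_def by blast
  then show "\<exists>U a. bforall_body cs m C n v U a" by blast
next
  assume "\<exists>U a. bforall_body cs m C n v U a"
  then obtain U a where body: "bforall_body cs m C n v U a" by blast
  define Q where "Q = U * U + 2 * U + 3"
  have U: "n \<le> U" "C \<le> U" "\<And>j. j < m \<Longrightarrow> v j \<le> U"
    and dvd: "\<And>j. j < m \<Longrightarrow> ((fact Q)\<^sup>2 - 1) choose n dvd (a j choose Suc U)"
    and cc: "\<And>c. c \<in> set cs \<Longrightarrow>
      cstr_cong (((fact Q)\<^sup>2 - 1) choose n) (case_sum a (case_nat ((fact Q)\<^sup>2 - 1) v)) c"
    using body unfolding bforall_body_def Q_def by blast+
  have nQ: "n \<le> Q" using U(1) unfolding Q_def by simp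
  have M: "((fact Q)\<^sup>2 - 1) choose n = (\<Prod>x<n. modulus Q x)"
    by (rule choose_eq_prod_modulus[OF nQ])
  show "\<forall>x<n. \<exists>w. \<forall>c\<in>set cs. holds (case_sum w (case_nat x v)) c"
  proof (intro allI impI)
    fix x assume x: "x < n"
    have xQ: "x < Q" using x nQ by simp
    have "fact Q div Suc x > 0"
      using xQ dvd_imp_le[OF dvd_fact[of "Suc x" Q]] by (simp add: div_greater_zero_iff)
    then have "fact Q * 1 \<le> Suc (modulus Q x)"
      unfolding Suc_modulus(1)[OF xQ] by (intro mult_le_mono2) simp
    moreover have "Q \<le> fact Q" by (rule fact_ge_self)
    ultimately have "modulus Q x \<noteq> 1" unfolding Q_def by simp
    \<comment> \<open>A prime is chosen because its divisibility of a falling factorial passes to a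
      single factor \<open>a j - i\<close> with \<open>i <= U\<close>.\<close>
    then obtain p where p: "prime p" "p dvd modulus Q x" using prime_factor_nat by blast
    have Qp: "Q < p" by (rule prime_dvd_modulus[OF p xQ])
    have "modulus Q x dvd (\<Prod>x<n. modulus Q x)" using x by (intro dvd_prodI) auto
    then have pM: "p dvd ((fact Q)\<^sup>2 - 1) choose n" unfolding M using p(2) dvd_trans by blast
    define w where "w j = a j mod p" for j
    have wU: "w j \<le> U" if "j < m" for j
    proof (cases "a j \<le> U")
      case True
      then show ?thesis unfolding w_def using mod_less_eq_dividend le_trans by blast
    next
      case False
      have "p dvd (a j choose Suc U)" using pM dvd[OF that] dvd_trans by blast
      then have "p dvd (\<Prod>i<Suc U. a j - i)" unfolding fact_times_choose[symmetric] by (rule dvd_mult)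
      then obtain i where i: "i < Suc U" "p dvd a j - i"
        using prime_dvd_prod_iff[of "{..<Suc U}" p "\<lambda>i. a j - i"] p(1) by auto
      then have "[a j = i] (mod p)" using False by (simp add: cong_altdef_nat)
      then have "w j = i mod p" unfolding w_def cong_def .
      also have "\<dots> = i" using i(1) Qp unfolding Q_def by (intro mod_less) simp
      finally show ?thesis using i(1) by simp
    qed
    have "holds (case_sum w (case_nat x v)) c" if c: "c \<in> set cs" for c
    proof (rule holds_if_cstr_cong)
      have cg: "[case_sum a (case_nat ((fact Q)\<^sup>2 - 1) v) i = case_sum w (case_nat x v) i] (mod p)" for i
        using cong_dvd_modulus_nat[OF modulus_cong[OF xQ] p(2)]
        by (auto simp: w_def cong_def split: sum.split nat.split)
      have c0: "cstr_cong p (case_sum a (case_nat ((fact Q)\<^sup>2 - 1) v)) c"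
        using cstr_cong_dvd[OF cc[OF c] pM] .
      show "cstr_cong p (case_sum w (case_nat x v)) c"
        by (rule iffD1[OF cstr_cong_cong c0]) (rule cg)
      show "U * U + 2 * U < p" using Qp unfolding Q_def by simp
      show "cstr_const c \<le> U" using const_le[OF c] U(2) by simp
      show "case_sum w (case_nat x v) i \<le> U" if "i \<in> set_cstr c" for i
        using that wU Inl_less[OF c] Inr_less[OF c] U x by (auto split: sum.splits nat.splits)
    qed
    then show "\<exists>w. \<forall>c\<in>set cs. holds (case_sum w (case_nat x v)) c" by blast
  qed
qed

lemma bforall_body_cong:
  assumes Inl_less: "\<And>c j. c \<in> set cs \<Longrightarrow> Inl j \<in> set_cstr c \<Longrightarrow> j < m"
    and "\<And>j. j < m \<Longrightarrow> a j = b j"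
  shows "bforall_body cs m C n v U a \<longleftrightarrow> bforall_body cs m C n v U b"
proof -
  have "cstr_cong M (case_sum a u) c \<longleftrightarrow> cstr_cong M (case_sum b u) c" if "c \<in> set cs" for M u c
    using Inl_less[OF that] assms(2) by (intro cstr_cong_cong) (auto split: sum.splits)
  then show ?thesis unfolding bforall_body_def using assms(2) by auto
qed

lemma dioph_cstr_cong:
  assumes "dfun M" "\<And>i. dfun (\<lambda>v. \<rho> v i)"
  shows "dioph (\<lambda>v. cstr_cong (M v) (\<rho> v) c)"
  using assms by (cases c) (auto intro!: dioph_arith_intros)

text \<open>Layout of the environment: the codes \<open>a j\<close> at indices below
  \<open>m\<close>, then \<open>U\<close>, then the bound \<open>n\<close>, then the
  parameters.\<close>

lemma dioph_bforall_body:
  "dioph (\<lambda>e. bforall_body cs m C (e (m + 1)) (\<lambda>j. e (m + 2 + j)) (e m) e)"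
proof -
  have T: "dfun (\<lambda>e. (fact (e m * e m + 2 * e m + 3))\<^sup>2 - 1)"
    by (intro dioph_fun_intros)
  have var: "dfun (\<lambda>e. case_sum e (case_nat ((fact (e m * e m + 2 * e m + 3))\<^sup>2 - 1) (\<lambda>j. e (m + 2 + j))) i)" for i
  proof (cases i)
    case (Inr j)
    show ?thesis using T unfolding Inr by (cases j) (simp_all add: dfun_var)
  qed (simp add: dfun_var)
  show ?thesis
    unfolding bforall_body_def
    by (intro dioph_conj dioph_all_less dioph_ball_list dioph_cstr_cong var dioph_fun_intros)
qed

lemma dioph_bounded_forall0:
  assumes "dioph P"
  shows "dioph (\<lambda>v. \<forall>x<v 0. P (case_nat x (\<lambda>i. v (Suc i))))"
proof -
  obtain cs where cs: "\<And>v. P v \<longleftrightarrow> (\<exists>w :: nat \<Rightarrow> nat. \<forall>c\<in>set cs. holds (case_sum w v) c)"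
    using dioph_normal_form[OF assms] by blast
  define V where "V = (\<Union>c\<in>set cs. set_cstr c)"
  have "finite V" unfolding V_def by auto
  then have "finite (case_sum id id ` V)" by simp
  then obtain m where m: "\<And>i. i \<in> V \<Longrightarrow> case_sum id id i < m"
    by (metis finite_nat_set_iff_bounded imageI)
  have Inl: "j < m" if "c \<in> set cs" "Inl j \<in> set_cstr c" for c j
    using m[of "Inl j"] that unfolding V_def by auto
  have Inr: "j < m" if "c \<in> set cs" "Inr (Suc j) \<in> set_cstr c" for c j
    using m[of "Inr (Suc j)"] that unfolding V_def by fastforce
  define C where "C = (\<Sum>c\<in>set cs. cstr_const c)"
  have C: "cstr_const c \<le> C" if "c \<in> set cs" for c
    using that unfolding C_def by (intro member_le_sum) auto
  let ?B = "\<lambda>e. bforall_body cs m C (e (m + 1)) (\<lambda>j. e (m + 2 + j)) (e m) e"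
  have "dioph (\<lambda>v. \<exists>U a. ?B (\<lambda>i. if i < m then a i else case_nat U v (i - m)))"
    by (rule dioph_ex0[OF dioph_ex_many[OF dioph_bforall_body]])
  moreover have "?B (\<lambda>i. if i < m then a i else case_nat U v (i - m))
      \<longleftrightarrow> bforall_body cs m C (v 0) (\<lambda>i. v (Suc i)) U a" for U v and a :: "nat \<Rightarrow> nat"
  proof -
    have "?B (\<lambda>i. if i < m then a i else case_nat U v (i - m))
      \<longleftrightarrow> bforall_body cs m C (v 0) (\<lambda>i. v (Suc i)) U (\<lambda>i. if i < m then a i else case_nat U v (i - m))"
      by simp
    also have "\<dots> \<longleftrightarrow> bforall_body cs m C (v 0) (\<lambda>i. v (Suc i)) U a"
      by (rule bforall_body_cong) (use Inl in auto)
    finally show ?thesis .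
  qed
  moreover have "(\<forall>x<v 0. P (case_nat x (\<lambda>i. v (Suc i))))
      \<longleftrightarrow> (\<exists>U a. bforall_body cs m C (v 0) (\<lambda>i. v (Suc i)) U a)" for v
    unfolding cs by (rule bounded_forall_iff) (use Inl Inr C in auto)
  ultimately show ?thesis by simp
qed

lemma dioph_bounded_forall:
  assumes "dioph (\<lambda>v. P (v 0) (\<lambda>i. v (Suc i)))" "dfun f"
  shows "dioph (\<lambda>v. \<forall>x<f v. P x v)"
  using dioph_apply[of "\<lambda>n v. \<forall>x<n. P x v", OF _ assms(2)] dioph_bounded_forall0[OF assms(1)]
  by simp

section \<open>Graphs of recursive functions\<close>

inductive_cases eval_ZfE: "eval Zf xs y"
inductive_cases eval_SfE: "eval Sf xs y"
inductive_cases eval_ProjE: "eval (Proj i) xs y"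
inductive_cases eval_CompE: "eval (Comp f gs) xs y"
inductive_cases eval_Prim_NilE: "eval (Prim f g) [] y"
inductive_cases eval_Prim_0E: "eval (Prim f g) (0 # xs) y"
inductive_cases eval_Prim_SucE: "eval (Prim f g) (Suc n # xs) y"
inductive_cases eval_MnE: "eval (Mn f) xs y"

lemma eval_deterministic: "eval f xs y \<Longrightarrow> eval f xs z \<Longrightarrow> y = z"
proof (induction arbitrary: z rule: eval.induct)
  case (ev_Comp xs gs ys f y)
  from ev_Comp.prems obtain zs where zs: "list_all2 (\<lambda>g y. eval g xs y) gs zs" "eval f zs z"
    by (rule eval_CompE)
  have "ys = zs"
  proof (rule nth_equalityI)
    show "length ys = length zs" using ev_Comp.IH(1) zs(1) by (auto dest!: list_all2_lengthD)
    show "ys ! i = zs ! i" if "i < length ys" for i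
      using ev_Comp.IH(1) zs(1) that by (auto simp: list_all2_conv_all_nth)
  qed
  then show ?case using ev_Comp.IH(2) zs(2) by simp
next
  case (ev_Mn f n xs)
  from ev_Mn.prems have z: "eval f (z # xs) 0" "\<forall>m<z. \<exists>k. eval f (m # xs) (Suc k)"
    by (auto elim: eval_MnE)
  have "\<not> n < z" using ev_Mn.IH(1) z(2) by fastforce
  moreover have "\<not> z < n" using ev_Mn.IH(2) z(1) by fastforce
  ultimately show ?case by simp
next
  case (ev_PrimS f g n xs y u z)
  from ev_PrimS.prems obtain y' where "eval (Prim f g) (n # xs) y'" "eval g (n # y' # xs) z"
    by (rule eval_Prim_SucE)
  then show ?case using ev_PrimS.IH by blast
next
  case (ev_Prim0 f xs y g)
  from ev_Prim0.prems have "eval f xs z" by (rule eval_Prim_0E)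
  then show ?case by (rule ev_Prim0.IH)
qed (auto elim: eval_ZfE eval_SfE eval_ProjE)

lemma eval_Prim_iff:
  "eval (Prim f g) (n # xs) y \<longleftrightarrow>
    (\<exists>q. eval f xs (q 0) \<and> (\<forall>j<n. eval g (j # q j # xs) (q (Suc j))) \<and> y = q n)"
proof
  show "eval (Prim f g) (n # xs) y \<Longrightarrow>
    \<exists>q. eval f xs (q 0) \<and> (\<forall>j<n. eval g (j # q j # xs) (q (Suc j))) \<and> y = q n"
  proof (induction n arbitrary: y)
    case 0
    then have "eval f xs y" by (rule eval_Prim_0E)
    then show ?case by (intro exI[of _ "\<lambda>_. y"]) simp
  next
    case (Suc n)
    then obtain y' where y': "eval (Prim f g) (n # xs) y'" "eval g (n # y' # xs) y"
      by (auto elim: eval_Prim_SucE)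
    from Suc.IH[OF y'(1)] obtain q where
      q: "eval f xs (q 0)" "\<forall>j<n. eval g (j # q j # xs) (q (Suc j))" "y' = q n" by blast
    let ?q = "q(Suc n := y)"
    have "eval f xs (?q 0) \<and> (\<forall>j<Suc n. eval g (j # ?q j # xs) (?q (Suc j))) \<and> y = ?q (Suc n)"
      using q y' by (auto simp: less_Suc_eq)
    then show ?case by blast
  qed
next
  assume "\<exists>q. eval f xs (q 0) \<and> (\<forall>j<n. eval g (j # q j # xs) (q (Suc j))) \<and> y = q n"
  then obtain q where
    q: "eval f xs (q 0)" "\<forall>j<n. eval g (j # q j # xs) (q (Suc j))" "y = q n" by blast
  have "j \<le> n \<Longrightarrow> eval (Prim f g) (j # xs) (q j)" for j
    using q by (induction j) (auto intro: eval.intros)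
  then show "eval (Prim f g) (n # xs) y" using q(3) by simp
qed

text \<open>As powers, quotients and remainders are already Diophantine, base-\<open>B\<close>
  digits can code finite sequences in place of the Goedel beta function.\<close>

lemma ex_digits:
  fixes y :: "nat \<Rightarrow> nat"
  assumes "\<forall>i\<le>n. y i < B"
  shows "\<exists>s. \<forall>i\<le>n. s div B ^ i mod B = y i"
  using assms
proof (induction n arbitrary: y)
  case 0
  then show ?case by (intro exI[of _ "y 0"]) simp
next
  case (Suc n)
  have "\<forall>i\<le>n. y (Suc i) < B" using Suc.prems by auto
  from Suc.IH[OF this] obtain s where s: "\<forall>i\<le>n. s div B ^ i mod B = y (Suc i)" by blast
  have y0: "y 0 < B" using Suc.prems by blast
  have "(y 0 + B * s) div B ^ i mod B = y i" if "i \<le> Suc n" for i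
  proof (cases i)
    case (Suc j)
    have "(y 0 + B * s) div B ^ i = (y 0 + B * s) div B div B ^ j"
      unfolding Suc by (simp only: power_Suc div_mult2_eq)
    also have "(y 0 + B * s) div B = s" using y0 by simp
    finally show ?thesis using s that Suc by simp
  qed (use y0 in simp)
  then show ?case by blast
qed

text \<open>The digits are named by quantified variables because the induction hypotheses of
  \<open>dioph_eval\<close> speak about variables only.\<close>

lemma eval_Prim_digits_iff:
  "eval (Prim f g) (n # xs) y \<longleftrightarrow> (\<exists>s B. (\<exists>p. p = s div B ^ 0 mod B \<and> eval f xs p) \<and>
    (\<forall>j<n. \<exists>p q. p = s div B ^ j mod B \<and> q = s div B ^ Suc j mod B \<and> eval g (j # p # xs) q) \<and>
    y = s div B ^ n mod B)" (is "_ \<longleftrightarrow> ?R")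
proof
  assume "eval (Prim f g) (n # xs) y"
  then obtain q where
    q: "eval f xs (q 0)" "\<forall>j<n. eval g (j # q j # xs) (q (Suc j))" "y = q n"
    unfolding eval_Prim_iff by blast
  define B where "B = Suc (\<Sum>j\<le>n. q j)"
  have "\<forall>i\<le>n. q i < B"
    using member_le_sum[of _ "{..n}" q] unfolding B_def by (auto simp: less_Suc_eq_le)
  then obtain s where "\<forall>i\<le>n. s div B ^ i mod B = q i" using ex_digits by blast
  then show ?R using q by (intro exI[of _ s] exI[of _ B]) (simp del: power_Suc power_0)
next
  assume ?R
  then obtain s B where "eval f xs (s div B ^ 0 mod B)"
    "\<forall>j<n. eval g (j # (s div B ^ j mod B) # xs) (s div B ^ Suc j mod B)"
    "y = s div B ^ n mod B" by blast
  then show "eval (Prim f g) (n # xs) y"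
    unfolding eval_Prim_iff by (intro exI[of _ "\<lambda>j. s div B ^ j mod B"]) blast
qed

theorem dioph_eval: "dioph (\<lambda>v. eval f (map v is) (v k))"
proof (induction f arbitrary: "is" k)
  case Zf
  have "eval Zf xs y \<longleftrightarrow> y = 0" for xs y by (auto elim: eval_ZfE intro: eval.intros)
  then show ?case by (simp add: dioph_const0)
next
  case Sf
  show ?case
  proof (cases "is")
    case Nil
    have "dioph (\<lambda>v. (0::nat) = 1)" by (intro dioph_intros)
    moreover have "\<not> eval Sf [] y" for y by (auto elim: eval_SfE)
    ultimately show ?thesis using Nil by simp
  next
    case (Cons i js)
    have "eval Sf (x # xs) y \<longleftrightarrow> y = Suc x" for x xs y by (auto elim: eval_SfE intro: eval.intros)
    moreover have "dioph (\<lambda>v. v k = Suc (v i))" by (intro dioph_intros)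
    ultimately show ?thesis using Cons by simp
  qed
next
  case (Proj i)
  have "eval (Proj i) xs y \<longleftrightarrow> i < length xs \<and> y = xs ! i" for xs y
    by (auto elim: eval_ProjE intro: eval.intros)
  moreover have "dioph (\<lambda>v. i < length is \<and> v k = v (is ! i))"
    by (intro dioph_order_intros)
  ultimately show ?case by (cases "i < length is") simp_all
next
  case (Comp f gs)
  define m where "m = length gs"
  \<comment> \<open>The intermediate values of \<open>gs\<close> occupy the first \<open>m\<close>
    indices, so the original variables are shifted by \<open>m\<close>.\<close>
  let ?P = "\<lambda>e. (\<forall>j<m. eval (gs ! j) (map e (map (\<lambda>i. i + m) is)) (e j)) \<and>
    eval f (map e [0..<m]) (e (k + m))"
  have "dioph ?P"
    by (intro dioph_conj dioph_all_less Comp.IH) (simp add: m_def)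
  then have "dioph (\<lambda>v. \<exists>w. ?P (\<lambda>i. if i < m then w i else v (i - m)))"
    by (rule dioph_ex_many)
  moreover have "(\<exists>w. ?P (\<lambda>i. if i < m then w i else v (i - m))) \<longleftrightarrow> eval (Comp f gs) (map v is) (v k)"
    (is "?L v \<longleftrightarrow> ?R v") for v
  proof -
    have "?L v \<longleftrightarrow> (\<exists>w. (\<forall>j<m. eval (gs ! j) (map v is) (w j)) \<and> eval f (map w [0..<m]) (v k))"
    proof -
      have *: "map (\<lambda>i. if i < m then w i else v (i - m)) [0..<m] = map w [0..<m]" for w by simp
      show ?thesis unfolding * by (simp add: comp_def)
    qed
    also have "\<dots> \<longleftrightarrow> ?R v"
    proof safe
      fix w assume "\<forall>j<m. eval (gs ! j) (map v is) (w j)" "eval f (map w [0..<m]) (v k)"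
      then show "?R v"
        by (intro ev_Comp[of _ gs "map w [0..<m]"]) (auto simp: list_all2_conv_all_nth m_def)
    next
      assume "?R v"
      then obtain ys where ys: "list_all2 (\<lambda>g y. eval g (map v is) y) gs ys" "eval f ys (v k)"
        by (rule eval_CompE)
      have "length ys = m" using list_all2_lengthD[OF ys(1)] by (simp add: m_def)
      then have "map (\<lambda>j. ys ! j) [0..<m] = ys" by (metis map_nth)
      then show "\<exists>w. (\<forall>j<m. eval (gs ! j) (map v is) (w j)) \<and> eval f (map w [0..<m]) (v k)"
        using ys by (intro exI[of _ "\<lambda>j. ys ! j"]) (auto simp: list_all2_conv_all_nth m_def)
    qed
    finally show ?thesis .
  qed
  ultimately show ?case by simp
next
  case (Prim f g)
  show ?case
  proof (cases "is")
    case Nil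
    have "dioph (\<lambda>v. (0::nat) = 1)" by (intro dioph_intros)
    moreover have "\<not> eval (Prim f g) [] y" for y by (auto elim: eval_Prim_NilE)
    ultimately show ?thesis using Nil by simp
  next
    case (Cons i js)
    have f: "dioph (\<lambda>v. eval f (map (\<lambda>i. v (h i)) js) (v l))" for h l
      using Prim.IH(1)[of "map h js" l] by (simp add: comp_def)
    have g: "dioph (\<lambda>v. eval g (v a # v b # map (\<lambda>i. v (h i)) js) (v l))" for h a b l
      using Prim.IH(2)[of "a # b # map h js" l] by (simp add: comp_def)
    show ?thesis
      unfolding Cons list.map eval_Prim_digits_iff
      by (intro dioph_ex dioph_conj dioph_bounded_forall f g dioph_fun_intros)
  qed
next
  case (Mn f)
  have f: "dioph (\<lambda>v. eval f (v a # map (\<lambda>i. v (h i)) is) (v l))" for h a l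
    using Mn.IH[of "a # map h is" l] by (simp add: comp_def)
  have "dioph (\<lambda>v. (\<exists>z. z = 0 \<and> eval f (v k # map v is) z) \<and>
      (\<forall>x<v k. \<exists>y z. z = Suc y \<and> eval f (x # map v is) z))"
    by (intro dioph_ex dioph_conj dioph_bounded_forall f dioph_fun_intros)
  moreover have "eval (Mn f) xs n \<longleftrightarrow> (\<exists>z. z = 0 \<and> eval f (n # xs) z) \<and>
      (\<forall>x<n. \<exists>y z. z = Suc y \<and> eval f (x # xs) z)" for xs n
    by (auto elim: eval_MnE intro: eval.intros)
  ultimately show ?case by simp
qed

section \<open>Nonnegative integers as sums of four rational squares\<close>

definition rat_four_squares :: "int \<Rightarrow> bool" where
  "rat_four_squares n \<longleftrightarrow> (\<exists>m a b c d. m \<noteq> 0 \<and> n * m\<^sup>2 = a\<^sup>2 + b\<^sup>2 + c\<^sup>2 + d\<^sup>2)"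

text \<open>Multiplicativity of the quaternion norm.\<close>

lemma euler_four_squares:
  fixes a b c d e f g h :: int
  shows "(a\<^sup>2 + b\<^sup>2 + c\<^sup>2 + d\<^sup>2) * (e\<^sup>2 + f\<^sup>2 + g\<^sup>2 + h\<^sup>2) =
    (a * e + b * f + c * g + d * h)\<^sup>2 + (a * f - b * e + c * h - d * g)\<^sup>2 +
    (a * g - b * h - c * e + d * f)\<^sup>2 + (a * h + b * g - c * f - d * e)\<^sup>2"
  by (simp add: power2_eq_square algebra_simps)

lemma rat_four_squares_mult:
  assumes "rat_four_squares n" "rat_four_squares k"
  shows "rat_four_squares (n * k)"
proof -
  obtain m a b c d where 1: "m \<noteq> 0" "n * m\<^sup>2 = a\<^sup>2 + b\<^sup>2 + c\<^sup>2 + d\<^sup>2"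
    using assms(1) unfolding rat_four_squares_def by blast
  obtain l e f g h where 2: "l \<noteq> 0" "k * l\<^sup>2 = e\<^sup>2 + f\<^sup>2 + g\<^sup>2 + h\<^sup>2"
    using assms(2) unfolding rat_four_squares_def by blast
  have "n * k * (m * l)\<^sup>2 = (n * m\<^sup>2) * (k * l\<^sup>2)" by (simp add: power_mult_distrib algebra_simps)
  then have "n * k * (m * l)\<^sup>2 = (a * e + b * f + c * g + d * h)\<^sup>2 + (a * f - b * e + c * h - d * g)\<^sup>2 +
    (a * g - b * h - c * e + d * f)\<^sup>2 + (a * h + b * g - c * f - d * e)\<^sup>2"
    unfolding 1(2) 2(2) euler_four_squares .
  moreover have "m * l \<noteq> 0" using 1 2 by simp
  ultimately show ?thesis unfolding rat_four_squares_def by blast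
qed

text \<open>Pigeonhole: for arguments in \<open>0..(p - 1) div 2\<close> the values
  \<open>a^2\<close> and \<open>-1 - b^2\<close> each give \<open>(p + 1) / 2\<close> distinct
  residues, together more than \<open>p\<close>.\<close>

lemma prime_dvd_two_squares_plus_one:
  fixes p :: int
  assumes "prime p" "odd p"
  obtains a b where "0 \<le> a" "2 * a < p" "0 \<le> b" "2 * b < p" "p dvd a\<^sup>2 + b\<^sup>2 + 1"
proof -
  define h where "h = (p - 1) div 2"
  have p: "p = 2 * h + 1" using assms(2) unfolding h_def by auto
  have h: "h \<ge> 0" using p prime_gt_0_int[OF assms(1)] by simp
  have inj: "x = y" if "p dvd x\<^sup>2 - y\<^sup>2" "0 \<le> x" "x \<le> h" "0 \<le> y" "y \<le> h" for x y
  proof (rule ccontr)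
    assume "x \<noteq> y"
    have "p dvd (x - y) * (x + y)" using that(1) by (simp add: power2_eq_square algebra_simps)
    then have "p dvd x - y \<or> p dvd x + y" using assms(1) by (simp add: prime_dvd_mult_iff)
    then show False
    proof
      assume "p dvd x - y"
      then have "\<bar>p\<bar> \<le> \<bar>x - y\<bar>" using \<open>x \<noteq> y\<close> by (intro dvd_imp_le_int) auto
      then show False using that p by linarith
    next
      assume "p dvd x + y"
      then have "p \<le> x + y" using \<open>x \<noteq> y\<close> that by (intro zdvd_imp_le) auto
      then show False using that p by linarith
    qed
  qed
  let ?f = "\<lambda>x. x\<^sup>2 mod p" and ?g = "\<lambda>x. (- 1 - x\<^sup>2) mod p"
  have "inj_on ?f {0..h}"
    by (intro inj_onI inj) (auto simp: mod_eq_dvd_iff)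
  then have cf: "card (?f ` {0..h}) = nat (h + 1)" by (simp add: card_image)
  have "inj_on ?g {0..h}"
  proof (intro inj_onI inj)
    fix x y assume "(- 1 - x\<^sup>2) mod p = (- 1 - y\<^sup>2) mod p"
    then have "p dvd y\<^sup>2 - x\<^sup>2" by (simp add: mod_eq_dvd_iff)
    then show "p dvd x\<^sup>2 - y\<^sup>2" by (simp add: dvd_diff_commute)
  qed auto
  then have cg: "card (?g ` {0..h}) = nat (h + 1)" by (simp add: card_image)
  have "?f ` {0..h} \<inter> ?g ` {0..h} \<noteq> {}"
  proof
    assume "?f ` {0..h} \<inter> ?g ` {0..h} = {}"
    then have "card (?f ` {0..h} \<union> ?g ` {0..h}) = nat (h + 1) + nat (h + 1)"
      using cf cg by (simp add: card_Un_disjoint)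
    moreover have "?f ` {0..h} \<union> ?g ` {0..h} \<subseteq> {0..<p}"
      using prime_gt_0_int[OF assms(1)] by auto
    then have "card (?f ` {0..h} \<union> ?g ` {0..h}) \<le> card {0..<p}" by (intro card_mono) auto
    ultimately show False using p h by simp
  qed
  then obtain a b where ab: "0 \<le> a" "a \<le> h" "0 \<le> b" "b \<le> h" "a\<^sup>2 mod p = (- 1 - b\<^sup>2) mod p" by auto
  then have "p dvd a\<^sup>2 + b\<^sup>2 + 1" by (simp add: mod_eq_dvd_iff algebra_simps)
  then show thesis using that ab p by simp
qed

text \<open>Allowing a common denominator replaces Lagrange's descent by plain induction: if
  \<open>p * k\<close> and \<open>k\<close> are sums of four rational squares, so is \<open>p = (p * k) * k / k\<^sup>2\<close>.\<close>

lemma rat_four_squares_prime: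
  fixes p :: int
  assumes "prime p" "\<And>k. 0 < k \<Longrightarrow> k < p \<Longrightarrow> rat_four_squares k"
  shows "rat_four_squares p"
proof (cases "odd p")
  case False
  then have "p = 2" using prime_odd_int[OF assms(1)] prime_gt_1_int[OF assms(1)] by linarith
  then have "p * 1\<^sup>2 = 1\<^sup>2 + 1\<^sup>2 + 0\<^sup>2 + 0\<^sup>2" by simp
  then show ?thesis unfolding rat_four_squares_def by (metis zero_neq_one)
next
  case True
  obtain a b where ab: "0 \<le> a" "2 * a < p" "0 \<le> b" "2 * b < p" "p dvd a\<^sup>2 + b\<^sup>2 + 1"
    using prime_dvd_two_squares_plus_one[OF assms(1) True] .
  then obtain k where k: "a\<^sup>2 + b\<^sup>2 + 1 = p * k" by blast
  have p0: "p > 1" using assms(1) prime_gt_1_int by blast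
  have "p * k > 0" unfolding k[symmetric] by (simp add: add_nonneg_pos)
  then have "k > 0" using p0 by (simp add: zero_less_mult_iff)
  moreover have "k < p"
  proof -
    have "(2 * a)\<^sup>2 \<le> (p - 1)\<^sup>2" "(2 * b)\<^sup>2 \<le> (p - 1)\<^sup>2" using ab by (intro power_mono; linarith)+
    then have "4 * (p * k) \<le> 2 * (p - 1)\<^sup>2 + 4" unfolding k[symmetric] by (simp add: power_mult_distrib)
    also have "\<dots> < 4 * (p * p)"
    proof -
      have "p * 2 \<le> p * p" using p0 by (intro mult_left_mono) auto
      moreover have "2 * (p - 1)\<^sup>2 + 4 = 2 * (p * p) - 4 * p + 6" by (simp add: power2_eq_square algebra_simps)
      ultimately show ?thesis using p0 by linarith
    qed
    finally show ?thesis using p0 by simp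
  qed
  ultimately have "rat_four_squares k" using assms(2) by blast
  moreover have "rat_four_squares (p * k)"
    unfolding rat_four_squares_def k[symmetric]
    by (intro exI[of _ 1] exI[of _ a] exI[of _ b] exI[of _ 0]) simp
  ultimately have "rat_four_squares (p * k * k)" by (rule rat_four_squares_mult[rotated])
  then obtain m s t u v where "m \<noteq> 0" "p * k * k * m\<^sup>2 = s\<^sup>2 + t\<^sup>2 + u\<^sup>2 + v\<^sup>2"
    unfolding rat_four_squares_def by blast
  then have "k * m \<noteq> 0" "p * (k * m)\<^sup>2 = s\<^sup>2 + t\<^sup>2 + u\<^sup>2 + v\<^sup>2"
    using \<open>k > 0\<close> by (simp_all add: power2_eq_square ac_simps)
  then show ?thesis unfolding rat_four_squares_def by blast
qed

lemma rat_four_squares_nat: "rat_four_squares (int n)"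
proof (induction n rule: less_induct)
  case (less n)
  consider "n = 0" | "n = 1" | "n > 1" by linarith
  then show ?case
  proof cases
    case 1
    then show ?thesis unfolding rat_four_squares_def
      by (intro exI[of _ 1] exI[of _ 0]) simp
  next
    case 2
    then show ?thesis unfolding rat_four_squares_def
      by (intro exI[of _ 1] exI[of _ 1] exI[of _ 0]) simp
  next
    case 3
    then obtain p where p: "prime p" "p dvd n" using prime_factor_nat[of n] by auto
    then obtain q where q: "n = p * q" by blast
    show ?thesis
    proof (cases "q = 1")
      case True
      have "prime (int n)" using p q True by simp
      moreover have "rat_four_squares k" if "0 < k" "k < int n" for k
        using less[of "nat k"] that by simp
      ultimately show ?thesis by (rule rat_four_squares_prime)
    next
      case False
      have "q > 0" using q 3 by (cases q) auto
      have "p > 1" using p(1) prime_gt_1_nat by blast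
      have "p < n" "q < n" using q False \<open>q > 0\<close> \<open>p > 1\<close> by auto
      then have "rat_four_squares (int p * int q)" using less rat_four_squares_mult by blast
      then show ?thesis using q by simp
    qed
  qed
qed

text \<open>An existential definition of being nonzero: neither \<open>2e + 1\<close> nor
  \<open>3f + 1\<close> vanishes, and conversely the odd part of \<open>m\<close> divides the first
  factor while its power of 2 divides a power of 4, which is 1 modulo 3.\<close>

lemma nonzero_dvd_iff:
  fixes m :: int
  shows "m \<noteq> 0 \<longleftrightarrow> (\<exists>e f g. (2 * e + 1) * (3 * f + 1) = m * g)"
proof
  have "\<exists>e f g. (2 * e + 1) * (3 * f + 1) = m * g" if "m \<noteq> 0" for m :: int
    using that
  proof (induction "nat \<bar>m\<bar>" arbitrary: m rule: less_induct)
    case less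
    show ?case
    proof (cases "even m")
      case True
      then obtain l where l: "m = 2 * l" by blast
      then have "nat \<bar>l\<bar> < nat \<bar>m\<bar>" "l \<noteq> 0" using less.prems by auto
      then obtain e f g where "(2 * e + 1) * (3 * f + 1) = l * g" using less.hyps by blast
      then have "(2 * e + 1) * (3 * (4 * f + 1) + 1) = m * (2 * g)" unfolding l by (simp add: algebra_simps)
      then show ?thesis by blast
    next
      case False
      then obtain e where "m = 2 * e + 1" by (elim oddE)
      then have "(2 * e + 1) * (3 * 0 + 1) = m * 1" by simp
      then show ?thesis by blast
    qed
  qed
  then show "m \<noteq> 0 \<Longrightarrow> \<exists>e f g. (2 * e + 1) * (3 * f + 1) = m * g" .
  assume "\<exists>e f g. (2 * e + 1) * (3 * f + 1) = m * g"
  then obtain e f g where *: "(2 * e + 1) * (3 * f + 1) = m * g" by blast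
  have "2 * e + 1 \<noteq> 0" "3 * f + 1 \<noteq> 0" by presburger+
  then show "m \<noteq> 0" using * by (metis mult_eq_0_iff)
qed

text \<open>Only binary sums, products and the constant 1 occur, so that each subterm becomes one
  constraint. The second equation expresses that the denominator \<open>m\<close> is
  nonzero.\<close>

lemma nonneg_int_iff:
  fixes z :: int
  shows "z \<ge> 0 \<longleftrightarrow> (\<exists>m a b c d e f g. z * (m * m) = a * a + b * b + (c * c + d * d) \<and>
    (e + e + 1) * (f + f + f + 1) = m * g)"
proof
  assume "z \<ge> 0"
  then have "rat_four_squares z" using rat_four_squares_nat[of "nat z"] by simp
  then obtain m a b c d where m: "m \<noteq> 0" "z * m\<^sup>2 = a\<^sup>2 + b\<^sup>2 + c\<^sup>2 + d\<^sup>2"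
    unfolding rat_four_squares_def by blast
  from m(1) obtain e f g where "(2 * e + 1) * (3 * f + 1) = m * g" using nonzero_dvd_iff by blast
  then have "(e + e + 1) * (f + f + f + 1) = m * g" by (simp add: algebra_simps)
  moreover have "z * (m * m) = a * a + b * b + (c * c + d * d)" using m(2) by (simp add: power2_eq_square)
  ultimately show "\<exists>m a b c d e f g. z * (m * m) = a * a + b * b + (c * c + d * d) \<and>
    (e + e + 1) * (f + f + f + 1) = m * g" by blast
next
  assume "\<exists>m a b c d e f g. z * (m * m) = a * a + b * b + (c * c + d * d) \<and>
    (e + e + 1) * (f + f + f + 1) = m * g"
  then obtain m a b c d e f g where *: "z * (m * m) = a * a + b * b + (c * c + d * d)"
    "(e + e + 1) * (f + f + f + 1) = m * g" by blast
  have "(2 * e + 1) * (3 * f + 1) = m * g" using *(2) by (simp add: algebra_simps)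
  then have "m \<noteq> 0" using nonzero_dvd_iff by blast
  then have "m * m > 0" by (simp add: zero_less_mult_iff) linarith
  moreover have "z * (m * m) \<ge> 0" unfolding *(1) by simp
  ultimately show "z \<ge> 0" by (simp add: zero_le_mult_iff)
qed

section \<open>A concrete model of the group\<close>

lemma winv_Nil [simp]: "winv [] = []"
  by (simp add: winv_def)

lemma winv_append [simp]: "winv (u @ v) = winv v @ winv u"
  by (simp add: winv_def)

lemma winv_Cons: "winv ((a, b) # w) = winv w @ [(a, \<not> b)]"
  by (simp add: winv_def)

lemma winv_winv [simp]: "winv (winv w) = w"
  by (induction w) (auto simp: winv_Cons)

declare eq_trans [trans]

lemma eqK2_winv_right: "eqK2 (w @ winv w) []"
proof (induction w)
  case (Cons l w)
  obtain a b where l: "l = (a, b)" by (cases l)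
  have "eqK2 ([(a, b)] @ (w @ winv w) @ [(a, \<not> b)]) ([(a, b)] @ [] @ [(a, \<not> b)])"
    by (intro eq_app eq_refl Cons)
  also have "eqK2 \<dots> []" using eq_cancel by simp
  finally show ?case by (simp add: l winv_Cons)
qed (simp add: eq_refl)

lemma eqK2_winv_left: "eqK2 (winv w @ w) []"
  using eqK2_winv_right[of "winv w"] by simp

lemma eqK2_winv_cong:
  assumes "eqK2 u v"
  shows "eqK2 (winv u) (winv v)"
proof -
  have "eqK2 (winv u @ []) (winv u @ (v @ winv v))"
    by (intro eq_app eq_refl eq_sym[OF eqK2_winv_right])
  also have "eqK2 \<dots> (winv u @ (u @ winv v))"
    by (intro eq_app eq_refl eq_sym[OF assms])
  also have "eqK2 \<dots> (winv v)"
    using eq_app[OF eqK2_winv_left[of u] eq_refl[of "winv v"]] by simp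
  finally show ?thesis by simp
qed

\<comment> \<open>The group as a quotient type, written additively though not commutative\<close>
quotient_type k2 = "gen word" / eqK2
  by (intro equivpI reflpI sympI transpI) (auto intro: eq_refl eq_sym eq_trans)

instantiation k2 :: group_add
begin

lift_definition zero_k2 :: k2 is "[]" .

lift_definition plus_k2 :: "k2 \<Rightarrow> k2 \<Rightarrow> k2" is "(@)" by (rule eq_app)

lift_definition uminus_k2 :: "k2 \<Rightarrow> k2" is winv by (rule eqK2_winv_cong)

lift_definition minus_k2 :: "k2 \<Rightarrow> k2 \<Rightarrow> k2" is "\<lambda>u v. u @ winv v"
  by (intro eq_app eqK2_winv_cong)

instance
  by standard (transfer; simp add: eq_refl eqK2_winv_left)+

end

section \<open>Integer powers\<close>

definition zpow :: "int \<Rightarrow> 'a::group_add \<Rightarrow> 'a" where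
  "zpow n g = (if n \<ge> 0 then ((+) g ^^ nat n) 0 else ((+) (- g) ^^ nat (- n)) 0)"

lemma zpow_0 [simp]: "zpow 0 g = 0"
  by (simp add: zpow_def)

lemma zpow_step: "zpow (n + 1) g = g + zpow n g"
proof (cases "n \<ge> 0")
  case True
  then have "nat (n + 1) = Suc (nat n)" by simp
  then show ?thesis using True by (simp add: zpow_def)
next
  case False
  have "nat (- n) = Suc (nat (- (n + 1)))" using False by simp
  then have "zpow n g = - g + ((+) (- g) ^^ nat (- (n + 1))) 0"
    using False by (simp add: zpow_def)
  moreover have "zpow (n + 1) g = ((+) (- g) ^^ nat (- (n + 1))) 0"
    using False by (cases "n = - 1") (simp_all add: zpow_def)
  ultimately show ?thesis by (simp add: add.assoc[symmetric])
qed

lemma zpow_step_down: "zpow (n - 1) g = - g + zpow n g"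
  using zpow_step[of "n - 1" g] by (simp add: add.assoc[symmetric])

lemma zpow_1 [simp]: "zpow 1 g = g"
  using zpow_step[of 0 g] by simp

lemma zpow_add: "zpow (m + n) g = zpow m g + zpow n g"
proof (induction m rule: int_induct[of _ 0])
  case (step1 i)
  have "zpow (i + 1 + n) g = zpow ((i + n) + 1) g" by (simp add: ac_simps)
  also have "\<dots> = g + (zpow i g + zpow n g)" by (simp only: zpow_step step1(2))
  finally show ?case by (simp only: zpow_step add.assoc)
next
  case (step2 i)
  have "zpow (i - 1 + n) g = zpow ((i + n) - 1) g" by (simp add: algebra_simps)
  also have "\<dots> = - g + (zpow i g + zpow n g)" by (simp only: zpow_step_down step2(2))
  finally show ?case by (simp only: zpow_step_down add.assoc)
qed simp

lemma zpow_minus: "zpow (- n) g = - zpow n g"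
  using zpow_add[of "- n" n g] by (simp add: eq_neg_iff_add_eq_0)

lemma zpow_hom:
  assumes "\<And>a b. \<phi> (a + b) = \<phi> a + (\<phi> b :: 'a::group_add)"
  shows "\<phi> (zpow n g) = zpow n (\<phi> g)"
proof -
  have zero: "\<phi> 0 = 0" using assms[of 0 0] by (metis add.right_neutral add_left_imp_eq)
  have minus: "\<phi> (- a) = - \<phi> a" for a using assms[of "- a" a] zero by (simp add: eq_neg_iff_add_eq_0)
  show ?thesis
    by (induction n rule: int_induct[of _ 0])
      (simp_all add: zero minus assms zpow_step zpow_step_down)
qed

lemma conj_zpow: "h + zpow n g - h = zpow n (h + g - h)"
proof (rule zpow_hom)
  show "h + (a + b) - h = h + a - h + (h + b - h)" for a b :: 'a
    by (simp add: diff_conv_add_uminus add.assoc del: add_uminus_conv_diff)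
qed

lemma zpow_commute: "h + g = g + h \<Longrightarrow> h + zpow n g = zpow n g + h"
  using conj_zpow[of h n g] by (simp add: diff_eq_eq)

lemma uminus_commute:
  fixes a b :: "'a::group_add"
  assumes "a + b = b + a"
  shows "- a + b = b + - a"
proof -
  have "- a + b = - a + (b + a) + - a" by (simp only: add.assoc right_minus add.right_neutral)
  also have "\<dots> = - a + (a + b) + - a" by (simp only: assms)
  also have "\<dots> = b + - a" by (simp only: minus_add_cancel)
  finally show ?thesis .
qed

lemma zpow_add_commuting:
  assumes "a + b = b + a"
  shows "zpow n (a + b) = zpow n a + zpow n b"
proof (induction n rule: int_induct[of _ 0])
  case (step1 i)
  have "b + zpow i a = zpow i a + b" using zpow_commute[of b a i] assms by simp
  then have *: "b + (zpow i a + z) = zpow i a + (b + z)" for z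
    by (simp only: add.assoc[symmetric])
  show ?case by (simp only: zpow_step step1(2) add.assoc *)
next
  case (step2 i)
  have "b + zpow (i - 1) a = zpow (i - 1) a + b" using zpow_commute[of b a "i - 1"] assms by simp
  then have c: "- b + zpow (i - 1) a = zpow (i - 1) a + - b"
    by (rule uminus_commute)
  have "- (a + b) + (zpow i a + zpow i b) = - b + (- a + zpow i a) + zpow i b"
    by (simp only: minus_add add.assoc)
  also have "\<dots> = (- b + zpow (i - 1) a) + zpow i b"
    by (simp only: zpow_step_down)
  also have "\<dots> = zpow (i - 1) a + zpow (i - 1) b"
    by (simp only: c zpow_step_down[of i b] add.assoc)
  finally show ?case by (simp only: zpow_step_down[of i "a + b"] step2(2))
qed simp

lemma zpow_zpow: "zpow m (zpow n g) = zpow (m * n) g"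
proof (induction m rule: int_induct[of _ 0])
  case (step1 i)
  have "(i + 1) * n = n + i * n" by (simp add: algebra_simps)
  then have "zpow ((i + 1) * n) g = zpow n g + zpow (i * n) g" by (simp only: zpow_add)
  then show ?case by (simp only: zpow_step step1(2))
next
  case (step2 i)
  have "(i - 1) * n = - n + i * n" by (simp add: algebra_simps)
  then have "zpow ((i - 1) * n) g = - zpow n g + zpow (i * n) g" by (simp only: zpow_add zpow_minus)
  then show ?case by (simp only: zpow_step_down step2(2))
qed simp

section \<open>Consequences of the relators\<close>

definition k2_x :: k2 where "k2_x = abs_k2 xx"
definition k2_t :: k2 where "k2_t = abs_k2 tt"
definition k2_y :: k2 where "k2_y = k2_t + k2_x + k2_t"
definition k2_c :: k2 where "k2_c = k2_x + k2_y - k2_x - k2_y"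

lemma k2_t_t: "k2_t + k2_t = 0"
proof -
  have "eqK2 (tt @ tt) []" by (rule eq_rel) (simp add: relators_K2_def)
  then show ?thesis
    unfolding k2_t_def plus_k2.abs_eq zero_k2_def by (simp only: k2.abs_eq_iff)
qed

lemma uminus_k2_t: "- k2_t = k2_t"
  using k2_t_t by (simp add: minus_unique)

lemma k2_t_cancel: "k2_t + (k2_t + g) = g"
  using k2_t_t by (simp add: add.assoc[symmetric])

lemma k2_x_commutes: "k2_x + (k2_y + k2_x - k2_y) = (k2_y + k2_x - k2_y) + k2_x"
proof -
  have "eqK2 (comm xx v_K2) []" by (rule eq_rel) (simp add: relators_K2_def)
  then have "abs_k2 (comm xx v_K2) = 0"
    unfolding zero_k2_def by (simp only: k2.abs_eq_iff)
  moreover have "abs_k2 v_K2 = k2_t + k2_x - k2_t + k2_x + k2_t - k2_x - k2_t"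
    unfolding v_K2_def k2_x_def k2_t_def plus_k2.abs_eq minus_k2.abs_eq uminus_k2.abs_eq by simp
  then have "abs_k2 v_K2 = k2_y + k2_x - k2_y"
    unfolding k2_y_def
    by (simp add: uminus_k2_t minus_add add.assoc diff_conv_add_uminus del: add_uminus_conv_diff)
  moreover have "abs_k2 (comm xx v_K2) = k2_x + abs_k2 v_K2 - k2_x - abs_k2 v_K2"
    unfolding comm_def k2_x_def plus_k2.abs_eq minus_k2.abs_eq uminus_k2.abs_eq by simp
  ultimately have "k2_x + (k2_y + k2_x - k2_y) - k2_x - (k2_y + k2_x - k2_y) = 0" by simp
  then show ?thesis by (simp only: right_minus_eq diff_eq_eq[of _ k2_x])
qed

lemma k2_t_conj: "k2_t + k2_x + k2_t = k2_y" "k2_t + k2_y + k2_t = k2_x"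
  "k2_t + k2_c + k2_t = - k2_c"
proof -
  show 1: "k2_t + k2_x + k2_t = k2_y" by (simp add: k2_y_def)
  show 2: "k2_t + k2_y + k2_t = k2_x" by (simp add: k2_y_def add.assoc k2_t_t k2_t_cancel)
  show "k2_t + k2_c + k2_t = - k2_c"
    unfolding k2_c_def k2_y_def
    by (simp add: uminus_k2_t k2_t_t k2_t_cancel minus_add add.assoc diff_conv_add_uminus
        del: add_uminus_conv_diff)
qed

text \<open>The conjugate of \<open>x\<close> by \<open>y\<close> is \<open>c^-1 x\<close>, so the
  relator says that \<open>x\<close> commutes with \<open>c^-1 x\<close>, hence with
  \<open>c\<close>.\<close>

lemma k2_x_c: "k2_x + k2_c = k2_c + k2_x"
proof -
  have "- k2_c + k2_x = k2_y + k2_x - k2_y"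
    unfolding k2_c_def by (simp add: minus_add add.assoc diff_conv_add_uminus del: add_uminus_conv_diff)
  then have "k2_x + (- k2_c + k2_x) = (- k2_c + k2_x) + k2_x" using k2_x_commutes by simp
  then have "- k2_c + k2_x = k2_x + - k2_c" by (simp only: add.assoc[symmetric] add_right_cancel)
  then have "- (- k2_c) + k2_x = k2_x + - (- k2_c)" by (rule uminus_commute)
  then show ?thesis by simp
qed

lemma k2_y_c: "k2_y + k2_c = k2_c + k2_y"
proof -
  have "(k2_t + k2_c + k2_t) + (k2_t + k2_x + k2_t) = k2_t + (k2_c + k2_x) + k2_t"
    by (simp only: add.assoc k2_t_cancel)
  also have "\<dots> = k2_t + (k2_x + k2_c) + k2_t" by (simp only: k2_x_c)
  also have "\<dots> = (k2_t + k2_x + k2_t) + (k2_t + k2_c + k2_t)"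
    by (simp only: add.assoc k2_t_cancel)
  finally have "- k2_c + k2_y = k2_y + - k2_c" unfolding k2_t_conj .
  then have "- (- k2_c) + k2_y = k2_y + - (- k2_c)" by (rule uminus_commute)
  then show ?thesis by simp
qed

lemma zpow_c_x: "zpow n k2_c + zpow m k2_x = zpow m k2_x + zpow n k2_c"
  using zpow_commute[OF zpow_commute[OF k2_x_c, symmetric]] .

lemma zpow_c_y: "zpow n k2_c + zpow m k2_y = zpow m k2_y + zpow n k2_c"
  using zpow_commute[OF zpow_commute[OF k2_y_c, symmetric]] .

text \<open>Since \<open>x y x^-1 = c y\<close>, conjugating \<open>y^i\<close> by \<open>x\<close>
  multiplies it by \<open>c^i\<close>. Equivalently \<open>y^-i x y^i = c^i x\<close>, and the
  \<open>j\<close>-th power of this is the collection formula.\<close>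

lemma zpow_y_x: "zpow i k2_y + zpow j k2_x = zpow j k2_x + zpow i k2_y + zpow (- (i * j)) k2_c"
proof -
  let ?y = "zpow i k2_y" and ?D = "zpow i k2_c"
  have "k2_x + k2_y - k2_x = k2_c + k2_y" by (simp add: k2_c_def)
  then have "k2_x + ?y - k2_x = zpow i (k2_c + k2_y)" by (simp add: conj_zpow)
  also have "\<dots> = ?D + ?y" by (rule zpow_add_commuting) (simp add: k2_y_c)
  finally have "k2_x + ?y = ?y + ?D + k2_x" by (simp add: diff_eq_eq zpow_c_y)
  then have conj: "- ?y + k2_x - (- ?y) = ?D + k2_x"
    by (simp add: add.assoc)
  have Dx: "?D + k2_x = k2_x + ?D" using zpow_c_x[of i 1] by simp
  have "- ?y + zpow j k2_x - (- ?y) = zpow j (?D + k2_x)" unfolding conj_zpow conj ..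
  also have "\<dots> = zpow (j * i) k2_c + zpow j k2_x"
    by (simp add: zpow_add_commuting[OF Dx] zpow_zpow)
  finally have "?y + (- ?y + zpow j k2_x - (- ?y)) = ?y + (zpow (j * i) k2_c + zpow j k2_x)" by simp
  then have "zpow j k2_x + ?y = ?y + (zpow (j * i) k2_c + zpow j k2_x)" by (simp add: add.assoc)
  also have "\<dots> = ?y + zpow j k2_x + zpow (j * i) k2_c" by (simp add: zpow_c_x add.assoc)
  finally show ?thesis by (simp add: zpow_minus mult.commute)
qed

section \<open>The model on coordinates\<close>

type_synonym heis2 = "int \<times> int \<times> int \<times> bool"

text \<open>\<open>(i, j, k, e)\<close> stands for \<open>x^i y^j c^k t^e\<close>. A
  \<open>t\<close> moving to the right swaps the exponents of \<open>x\<close> and \<open>y\<close>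
  and inverts \<open>c\<close>; the products subtracted come from moving powers of \<open>x\<close>
  to the left of powers of \<open>y\<close>.\<close>

fun gmul :: "heis2 \<Rightarrow> heis2 \<Rightarrow> heis2" where
  "gmul (i, j, k, e) (i', j', k', e') =
    (if e then (i + j', j + i', k - k' - i' * j' - j * j', \<not> e')
     else (i + i', j + j', k + k' - j * i', e'))"

definition gone :: heis2 where "gone = (0, 0, 0, False)"

fun ginv :: "heis2 \<Rightarrow> heis2" where
  "ginv (i, j, k, e) = (if e then (- j, - i, k, True) else (- i, - j, - k - i * j, False))"

fun gletter :: "gen \<times> bool \<Rightarrow> heis2" where
  "gletter (GX, b) = (if b then - 1 else 1, 0, 0, False)"
| "gletter (GT, b) = (0, 0, 0, True)"

definition gval :: "gen word \<Rightarrow> heis2" where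
  "gval w = foldr (\<lambda>l. gmul (gletter l)) w gone"

lemma gmul_assoc: "gmul (gmul a b) c = gmul a (gmul b c)"
  by (cases a; cases b; cases c) (auto simp: algebra_simps)

lemma gmul_gone [simp]: "gmul gone a = a" "gmul a gone = a"
  by (cases a; simp add: gone_def)+

lemma gmul_ginv [simp]: "gmul a (ginv a) = gone" "gmul (ginv a) a = gone"
  by (cases a; simp add: gone_def algebra_simps)+

lemma gmul_ginv_eq_gone_iff: "gmul a (ginv b) = gone \<longleftrightarrow> a = b"
proof
  assume "gmul a (ginv b) = gone"
  then have "gmul (gmul a (ginv b)) b = b" by simp
  then show "a = b" by (simp add: gmul_assoc)
qed simp

lemma gval_Nil [simp]: "gval [] = gone"
  by (simp add: gval_def)

lemma gval_Cons: "gval (l # w) = gmul (gletter l) (gval w)"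
  by (simp add: gval_def)

lemma gval_append [simp]: "gval (u @ v) = gmul (gval u) (gval v)"
  by (induction u) (simp_all add: gval_Cons gmul_assoc)

lemma gval_winv [simp]: "gval (winv w) = ginv (gval w)"
proof -
  have "gmul (gval w) (gval (winv w)) = gone"
  proof (induction w)
    case (Cons l w)
    obtain a b where l: "l = (a, b)" by (cases l)
    have "gmul (gletter (a, b)) (gletter (a, \<not> b)) = gone" by (cases a) (auto simp: gone_def)
    moreover have "gmul (gval (l # w)) (gval (winv (l # w)))
        = gmul (gletter (a, b)) (gmul (gmul (gval w) (gval (winv w))) (gletter (a, \<not> b)))"
      by (simp add: l winv_Cons gval_Cons gmul_assoc)
    ultimately show ?case using Cons by simp
  qed simp
  then have "gmul (gmul (ginv (gval w)) (gval w)) (gval (winv w)) = ginv (gval w)"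
    by (simp only: gmul_assoc gmul_gone)
  then show ?thesis by simp
qed

lemma gval_sound: "eqK2 u v \<Longrightarrow> gval u = gval v"
proof (induction rule: eqK2.induct)
  case (eq_cancel a b)
  show ?case by (cases a) (auto simp: gval_Cons gone_def)
next
  case (eq_rel r)
  then show ?case
    by (auto simp: relators_K2_def comm_def v_K2_def gval_Cons gone_def)
qed simp_all

section \<open>Normal forms and faithfulness of the model\<close>

fun k2_nf :: "heis2 \<Rightarrow> k2" where
  "k2_nf (i, j, k, e) = zpow i k2_x + zpow j k2_y + zpow k k2_c + (if e then k2_t else 0)"

lemma k2_t_zpow: "k2_t + zpow n g = zpow n (k2_t + g + k2_t) + k2_t"
proof -
  have "k2_t + zpow n g + k2_t = zpow n (k2_t + g + k2_t)"
    using conj_zpow[of k2_t n g] by (simp add: uminus_k2_t diff_conv_add_uminus del: add_uminus_conv_diff)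
  then have "k2_t + zpow n g + k2_t + k2_t = zpow n (k2_t + g + k2_t) + k2_t" by simp
  then show ?thesis by (simp add: add.assoc k2_t_t)
qed

lemma k2_t_zpow_add:
  "k2_t + (zpow n k2_x + h) = zpow n k2_y + (k2_t + h)"
  "k2_t + (zpow n k2_y + h) = zpow n k2_x + (k2_t + h)"
  "k2_t + zpow n k2_c = zpow n (- k2_c) + k2_t"
  using k2_t_zpow[of n k2_x] k2_t_zpow[of n k2_y] k2_t_zpow[of n k2_c]
  unfolding k2_t_conj by (simp_all add: add.assoc[symmetric])

lemma k2_nf_gletter: "abs_k2 [l] + k2_nf g = k2_nf (gmul (gletter l) g)"
proof -
  obtain i j k e where g: "g = (i, j, k, e)" by (cases g)
  obtain a b where l: "l = (a, b)" by (cases l)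
  show ?thesis
  proof (cases a)
    case GX
    have "abs_k2 [(GX, b)] = zpow (if b then - 1 else 1) k2_x"
      using zpow_minus[of 1 k2_x] by (simp add: k2_x_def uminus_k2.abs_eq winv_def)
    then show ?thesis
      by (simp add: l g GX zpow_add add.assoc)
  next
    case GT
    have "abs_k2 [(GT, True)] = - k2_t"
      unfolding k2_t_def by (simp add: uminus_k2.abs_eq winv_def)
    then have t: "abs_k2 [(GT, b)] = k2_t" by (cases b) (simp_all add: uminus_k2_t, simp add: k2_t_def)
    have "k2_t + (zpow i k2_x + zpow j k2_y + zpow k k2_c)
        = zpow i k2_y + zpow j k2_x + zpow k (- k2_c) + k2_t"
      by (simp only: add.assoc k2_t_zpow_add)
    also have "zpow k (- k2_c) = zpow (- k) k2_c"
      using zpow_zpow[of k "- 1" k2_c] by (simp add: zpow_minus)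
    also have "zpow i k2_y + zpow j k2_x + zpow (- k) k2_c
        = zpow j k2_x + zpow i k2_y + zpow (- k - i * j) k2_c"
    proof -
      have "- k - i * j = - (i * j) + - k" by simp
      then show ?thesis by (simp only: zpow_y_x zpow_add add.assoc)
    qed
    finally have "k2_t + k2_nf g = zpow j k2_x + zpow i k2_y + zpow (- k - i * j) k2_c
        + (k2_t + (if e then k2_t else 0))"
      by (simp only: g k2_nf.simps add.assoc[symmetric])
    then show ?thesis by (cases e) (simp_all add: l g GT t k2_t_t)
  qed
qed

text \<open>By \<open>k2_nf_gletter\<close> every word equals the normal form read off from its
  value. With \<open>gval_sound\<close> this replaces derivations in \<open>eqK2\<close> by integer
  arithmetic.\<close>

lemma gval_complete:
  assumes "gval w = gone"
  shows "eqK2 w []"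
proof -
  have "abs_k2 w = k2_nf (gval w)"
  proof (induction w)
    case Nil
    have "abs_k2 [] = 0" by (simp add: zero_k2_def)
    then show ?case by (simp add: gone_def)
  next
    case (Cons l w)
    have "abs_k2 (l # w) = abs_k2 [l] + abs_k2 w" by (simp add: plus_k2.abs_eq)
    then show ?case using Cons by (simp add: k2_nf_gletter gval_Cons)
  qed
  then have "abs_k2 w = 0" using assms by (simp add: gone_def)
  then have "abs_k2 w = abs_k2 []" by (simp only: zero_k2_def)
  then show ?thesis by (simp only: k2.abs_eq_iff)
qed

lemma eqK2_Nil_iff: "eqK2 w [] \<longleftrightarrow> gval w = gone"
  using gval_sound[of w "[]"] gval_complete by auto

section \<open>Interpretation of the integers\<close>

lemma subst_append [simp]: "subst \<sigma> (u @ v) = subst \<sigma> u @ subst \<sigma> v"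
  by (simp add: subst_def)

lemma subst_Nil [simp]: "subst \<sigma> [] = []"
  by (simp add: subst_def)

lemma subst_Cons: "subst \<sigma> ((c, b) # w) =
    (case c of Inl g \<Rightarrow> [(g, b)] | Inr i \<Rightarrow> (if b then winv (\<sigma> i) else \<sigma> i)) @ subst \<sigma> w"
  by (simp add: subst_def)

lemma subst_winv [simp]: "subst \<sigma> (winv w) = winv (subst \<sigma> w)"
proof (induction w)
  case (Cons l w)
  obtain c b where "l = (c, b)" by (cases l)
  then show ?case using Cons by (auto simp: winv_Cons subst_Cons split: sum.split)
qed simp

abbreviation u_var :: "nat \<Rightarrow> equation" where "u_var i \<equiv> [(Inr (2 * i), False)]"
abbreviation v_var :: "nat \<Rightarrow> equation" where "v_var i \<equiv> [(Inr (Suc (2 * i)), False)]"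
abbreviation x_word :: equation where "x_word \<equiv> [(Inl GX, False)]"
abbreviation y_word :: equation where "y_word \<equiv> [(Inl GT, False), (Inl GX, False), (Inl GT, False)]"

definition equate :: "equation \<Rightarrow> equation \<Rightarrow> equation" where
  "equate l r = l @ winv r"

text \<open>The integer \<open>\<rho> i\<close> is represented by \<open>x^(\<rho> i) c^k\<close> (the value of \<^term>\<open>u_var i\<close>) and by
  \<open>y^(\<rho> i) c^l\<close> (the value of \<^term>\<open>v_var i\<close>), with \<open>y = txt\<close> and \<open>c = [x, y]\<close>;
  multiplication is \<open>[x^a, y^b] = c^(a b)\<close>.\<close>

definition var_eqs :: "nat \<Rightarrow> equation list" where
  "var_eqs i = [equate (u_var i @ x_word) (x_word @ u_var i),
    equate (v_var i @ y_word) (y_word @ v_var i),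
    equate (comm (u_var i) y_word) (comm x_word (v_var i))]"

text \<open>Taking the commutator with \<open>y\<close> removes the unknown power of
  \<open>c\<close> in the value of \<open>u_var i\<close> and turns the exponent of \<open>x\<close>
  into one of \<open>c\<close>; addition then becomes the product of powers of
  \<open>c\<close>.\<close>

fun cstr_eq :: "nat cstr \<Rightarrow> equation" where
  "cstr_eq (Const_eq i n) =
    equate (comm (u_var i) y_word) (comm (replicate n (Inl GX, False)) y_word)"
| "cstr_eq (Add_eq i j k) =
    equate (comm (u_var i) y_word) (comm (u_var j) y_word @ comm (u_var k) y_word)"
| "cstr_eq (Mult_eq i j k) =
    equate (comm (u_var i) y_word) (comm (u_var j) (v_var k))"

text \<open>Forces \<open>u_var 0\<close> to be exactly \<open>x^n\<close>. Passing from
  \<open>n\<close> to \<open>n + 1\<close> prepends one letter, which makes the code computable by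
  primitive recursion.\<close>

definition param_eq :: "nat \<Rightarrow> equation" where
  "param_eq n = replicate n (Inl GX, False) @ [(Inr 0, True)]"

definition gcomm :: "heis2 \<Rightarrow> heis2 \<Rightarrow> heis2" where
  "gcomm a b = gmul a (gmul b (gmul (ginv a) (ginv b)))"

lemma gcomm_xy: "gcomm (a, 0, k, False) (0, b, l, False) = (0, 0, a * b, False)"
  by (simp add: gcomm_def algebra_simps)

lemma eqK2_equate_iff:
  "eqK2 (subst \<sigma> (equate l r)) [] \<longleftrightarrow> gval (subst \<sigma> l) = gval (subst \<sigma> r)"
  by (simp add: eqK2_Nil_iff equate_def gmul_ginv_eq_gone_iff)

lemma gval_subst_comm: "gval (subst \<sigma> (comm u v)) = gcomm (gval (subst \<sigma> u)) (gval (subst \<sigma> v))"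
  by (simp add: comm_def gcomm_def)

lemma gval_subst_words:
  "gval (subst \<sigma> x_word) = (1, 0, 0, False)" "gval (subst \<sigma> y_word) = (0, 1, 0, False)"
  "gval (subst \<sigma> (u_var i)) = gval (\<sigma> (2 * i))" "gval (subst \<sigma> (v_var i)) = gval (\<sigma> (Suc (2 * i)))"
  by (simp_all add: subst_Cons gval_Cons gone_def)

lemma gval_replicate_x: "gval (replicate n (GX, b)) = (if b then - int n else int n, 0, 0, False)"
  by (induction n) (auto simp: gval_Cons gone_def)

lemma gval_subst_replicate_x:
  "gval (subst \<sigma> (replicate n (Inl GX, False))) = (int n, 0, 0, False)"
  by (induction n) (auto simp: subst_Cons gval_Cons gone_def)

text \<open>For elements involving \<open>t\<close>, left and right multiplication by
  \<open>x\<close> raise different coordinates; otherwise the \<open>c\<close>-coordinate forces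
  \<open>j = 0\<close>.\<close>

lemma centralizer_x:
  "gmul g (1, 0, 0, False) = gmul (1, 0, 0, False) g \<longleftrightarrow> (\<exists>a k. g = (a, 0, k, False))"
  by (cases g) auto

lemma centralizer_y:
  "gmul g (0, 1, 0, False) = gmul (0, 1, 0, False) g \<longleftrightarrow> (\<exists>b k. g = (0, b, k, False))"
  by (cases g) auto

lemma solvable_iff_integer_solution:
  assumes vars: "\<And>c. c \<in> set cs \<Longrightarrow> set_cstr c \<subseteq> {..<m}" and "0 < m"
  shows "solvable_K2 (param_eq n # concat (map var_eqs [0..<m]) @ map cstr_eq cs) \<longleftrightarrow>
    (\<exists>\<rho> :: nat \<Rightarrow> int. \<rho> 0 = int n \<and> (\<forall>c\<in>set cs. holds \<rho> c))"
proof -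
  have sat_cstr: "eqK2 (subst \<sigma> (cstr_eq c)) [] \<longleftrightarrow> holds \<rho> c"
    if "\<And>i. i \<in> set_cstr c \<Longrightarrow> \<exists>k. gval (\<sigma> (2 * i)) = (\<rho> i, 0, k, False)"
      "\<And>i. i \<in> set_cstr c \<Longrightarrow> \<exists>k. gval (\<sigma> (Suc (2 * i))) = (0, \<rho> i, k, False)"
    for \<sigma> and \<rho> :: "nat \<Rightarrow> int" and c
  proof (cases c)
    case (Const_eq i k)
    then show ?thesis using that(1)[of i]
      by (auto simp: eqK2_equate_iff gval_subst_comm gval_subst_words gval_subst_replicate_x gcomm_xy)
  next
    case (Add_eq i j k)
    then show ?thesis using that(1)[of i] that(1)[of j] that(1)[of k]
      by (auto simp: eqK2_equate_iff gval_subst_comm gval_subst_words gcomm_xy)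
  next
    case (Mult_eq i j k)
    then show ?thesis using that(1)[of i] that(1)[of j] that(2)[of k]
      by (auto simp: eqK2_equate_iff gval_subst_comm gval_subst_words gcomm_xy)
  qed
  have param: "eqK2 (subst \<sigma> (param_eq n)) [] \<longleftrightarrow> gval (\<sigma> 0) = (int n, 0, 0, False)" for \<sigma>
    by (auto simp: eqK2_Nil_iff param_eq_def gval_subst_replicate_x subst_Cons gmul_ginv_eq_gone_iff
        simp del: gmul.simps)
  show ?thesis
  proof
    assume "solvable_K2 (param_eq n # concat (map var_eqs [0..<m]) @ map cstr_eq cs)"
    then obtain \<sigma> where
      \<sigma>: "\<forall>e\<in>set (param_eq n # concat (map var_eqs [0..<m]) @ map cstr_eq cs). eqK2 (subst \<sigma> e) []"
      unfolding solvable_K2_def by blast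
    have p: "eqK2 (subst \<sigma> (param_eq n)) []" using \<sigma> by simp
    have v: "eqK2 (subst \<sigma> e) []" if "i < m" "e \<in> set (var_eqs i)" for i e
      using \<sigma> that by (auto simp: ball_Un)
    have c: "eqK2 (subst \<sigma> (cstr_eq c)) []" if "c \<in> set cs" for c
      using \<sigma> that by (simp add: ball_Un)
    define \<rho> where "\<rho> i = fst (gval (\<sigma> (2 * i)))" for i
    have uv: "(\<exists>k. gval (\<sigma> (2 * i)) = (\<rho> i, 0, k, False)) \<and>
        (\<exists>k. gval (\<sigma> (Suc (2 * i))) = (0, \<rho> i, k, False))" if "i < m" for i
    proof -
      have "gmul (gval (\<sigma> (2 * i))) (1, 0, 0, False) = gmul (1, 0, 0, False) (gval (\<sigma> (2 * i)))"
        using v[OF that, of "equate (u_var i @ x_word) (x_word @ u_var i)"]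
        unfolding eqK2_equate_iff subst_append gval_append gval_subst_words by (simp add: var_eqs_def)
      then obtain a k where u: "gval (\<sigma> (2 * i)) = (a, 0, k, False)"
        unfolding centralizer_x by blast
      have "gmul (gval (\<sigma> (Suc (2 * i)))) (0, 1, 0, False) = gmul (0, 1, 0, False) (gval (\<sigma> (Suc (2 * i))))"
        using v[OF that, of "equate (v_var i @ y_word) (y_word @ v_var i)"]
        unfolding eqK2_equate_iff subst_append gval_append gval_subst_words by (simp add: var_eqs_def)
      then obtain b l where w: "gval (\<sigma> (Suc (2 * i))) = (0, b, l, False)"
        unfolding centralizer_y by blast
      have "gcomm (a, 0, k, False) (0, 1, 0, False) = gcomm (1, 0, 0, False) (0, b, l, False)"
        using v[OF that, of "equate (comm (u_var i) y_word) (comm x_word (v_var i))"] u w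
        unfolding eqK2_equate_iff gval_subst_comm gval_subst_words by (simp add: var_eqs_def)
      then have "a = b" by (simp add: gcomm_xy)
      then show ?thesis using u w by (simp add: \<rho>_def)
    qed
    have "holds \<rho> c" if "c \<in> set cs" for c
      using sat_cstr[of c \<sigma> \<rho>] uv vars[OF that] c[OF that] by blast
    moreover have "\<rho> 0 = int n" using p unfolding param \<rho>_def by simp
    ultimately show "\<exists>\<rho> :: nat \<Rightarrow> int. \<rho> 0 = int n \<and> (\<forall>c\<in>set cs. holds \<rho> c)" by blast
  next
    assume "\<exists>\<rho> :: nat \<Rightarrow> int. \<rho> 0 = int n \<and> (\<forall>c\<in>set cs. holds \<rho> c)"
    then obtain \<rho> :: "nat \<Rightarrow> int" where \<rho>: "\<rho> 0 = int n" "\<And>c. c \<in> set cs \<Longrightarrow> holds \<rho> c" by blast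
    define xp where "xp a = replicate (nat \<bar>a\<bar>) (GX, a < 0)" for a :: int
    have xp: "gval (xp a) = (a, 0, 0, False)" for a
      by (simp add: xp_def gval_replicate_x)
    \<comment> \<open>Odd variables receive the conjugate by \<open>t\<close>, which is the same
      power of \<open>y\<close>.\<close>
    define \<sigma> where "\<sigma> i = (if even i then xp (\<rho> (i div 2)) else tt @ xp (\<rho> (i div 2)) @ tt)" for i
    have uv: "gval (\<sigma> (2 * i)) = (\<rho> i, 0, 0, False)" "gval (\<sigma> (Suc (2 * i))) = (0, \<rho> i, 0, False)" for i
      by (simp_all add: \<sigma>_def xp gval_Cons gone_def)
    have "eqK2 (subst \<sigma> (param_eq n)) []" using uv(1)[of 0] \<rho>(1) unfolding param by simp
    moreover have "eqK2 (subst \<sigma> e) []" if "e \<in> set (var_eqs i)" for e i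
    proof -
      have "eqK2 (subst \<sigma> (equate (u_var i @ x_word) (x_word @ u_var i))) []"
        "eqK2 (subst \<sigma> (equate (v_var i @ y_word) (y_word @ v_var i))) []"
        "eqK2 (subst \<sigma> (equate (comm (u_var i) y_word) (comm x_word (v_var i)))) []"
        unfolding eqK2_equate_iff subst_append gval_append gval_subst_comm gval_subst_words uv
          gcomm_xy by simp_all
      then show ?thesis using that by (auto simp: var_eqs_def)
    qed
    moreover have "eqK2 (subst \<sigma> (cstr_eq c)) []" if "c \<in> set cs" for c
      using sat_cstr[of c \<sigma> \<rho>] uv \<rho>(2)[OF that] by blast
    ultimately show "solvable_K2 (param_eq n # concat (map var_eqs [0..<m]) @ map cstr_eq cs)"
      unfolding solvable_K2_def by (intro exI[of _ \<sigma>]) auto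
  qed
qed

text \<open>The variable \<open>v 0\<close> is the integer to be nonnegative; \<open>m, a, b, c, d, e, f, g\<close> of
  \<open>nonneg_int_iff\<close> are \<open>v 1, v 4, v 6, v 8, v 10, v 15, v 18, v 23\<close>.\<close>

definition nonneg_cstrs :: "nat \<Rightarrow> (nat \<times> nat) cstr list" where
  "nonneg_cstrs i = (let v = Pair i in
    [Mult_eq (v 2) (v 1) (v 1), Mult_eq (v 3) (v 0) (v 2),
     Mult_eq (v 5) (v 4) (v 4), Mult_eq (v 7) (v 6) (v 6),
     Mult_eq (v 9) (v 8) (v 8), Mult_eq (v 11) (v 10) (v 10),
     Add_eq (v 12) (v 5) (v 7), Add_eq (v 13) (v 9) (v 11), Add_eq (v 3) (v 12) (v 13),
     Const_eq (v 14) 1, Add_eq (v 16) (v 15) (v 15), Add_eq (v 17) (v 16) (v 14),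
     Add_eq (v 19) (v 18) (v 18), Add_eq (v 20) (v 19) (v 18), Add_eq (v 21) (v 20) (v 14),
     Mult_eq (v 22) (v 17) (v 21), Mult_eq (v 22) (v 1) (v 23)])"

lemma nonneg_cstrs_sound:
  fixes \<rho> :: "nat \<times> nat \<Rightarrow> int"
  assumes "\<forall>c\<in>set (nonneg_cstrs i). holds \<rho> c"
  shows "\<rho> (i, 0) \<ge> 0"
proof -
  let ?r = "\<lambda>s. \<rho> (i, s)"
  have "list_all (holds \<rho>) (nonneg_cstrs i)" using assms by (simp only: list_all_iff)
  then have h: "?r 2 = ?r 1 * ?r 1" "?r 3 = ?r 0 * ?r 2" "?r 5 = ?r 4 * ?r 4" "?r 7 = ?r 6 * ?r 6"
    "?r 9 = ?r 8 * ?r 8" "?r 11 = ?r 10 * ?r 10" "?r 12 = ?r 5 + ?r 7" "?r 13 = ?r 9 + ?r 11"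
    "?r 3 = ?r 12 + ?r 13" "?r 14 = 1" "?r 16 = ?r 15 + ?r 15" "?r 17 = ?r 16 + ?r 14"
    "?r 19 = ?r 18 + ?r 18" "?r 20 = ?r 19 + ?r 18" "?r 21 = ?r 20 + ?r 14"
    "?r 22 = ?r 17 * ?r 21" "?r 22 = ?r 1 * ?r 23"
    unfolding nonneg_cstrs_def Let_def list.pred_inject holds.simps of_nat_1 by blast+
  have "?r 0 * (?r 1 * ?r 1) = ?r 4 * ?r 4 + ?r 6 * ?r 6 + (?r 8 * ?r 8 + ?r 10 * ?r 10)"
    by (simp only: flip: h)
  moreover have "(?r 15 + ?r 15 + 1) * (?r 18 + ?r 18 + ?r 18 + 1) = ?r 1 * ?r 23"
    by (simp only: flip: h)
  ultimately show ?thesis unfolding nonneg_int_iff by blast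
qed

lemma nonneg_cstrs_complete:
  fixes z :: int
  assumes "z \<ge> 0"
  shows "\<exists>\<tau>. \<tau> 0 = z \<and> (\<forall>i \<rho>. (\<forall>s. \<rho> (i, s) = \<tau> s) \<longrightarrow> (\<forall>c\<in>set (nonneg_cstrs i). holds \<rho> c))"
proof -
  obtain m a b c d e f g where *: "z * (m * m) = a * a + b * b + (c * c + d * d)"
    "(e + e + 1) * (f + f + f + 1) = m * g" using assms unfolding nonneg_int_iff by blast
  \<comment> \<open>Position \<open>s\<close> is the value of the variable \<open>v s\<close>; entry
    22 serves both of its defining products by the second equation.\<close>
  let ?l = "[z, m, m * m, z * (m * m), a, a * a, b, b * b, c, c * c, d, d * d, a * a + b * b,
    c * c + d * d, 1, e, e + e, e + e + 1, f, f + f, f + f + f, f + f + f + 1, m * g, g]"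
  show ?thesis
    by (rule exI[of _ "\<lambda>s. ?l ! s"]) (use * in \<open>simp add: nonneg_cstrs_def Let_def\<close>)
qed

section \<open>From natural to integer solutions\<close>

lemma holds_of_nat: "holds (\<lambda>i. int (\<rho> i)) c \<longleftrightarrow> holds \<rho> c"
  by (cases c) (auto simp flip: of_nat_add of_nat_mult)

lemma holds_cong: "(\<And>i. i \<in> set_cstr c \<Longrightarrow> \<rho> i = \<rho>' i) \<Longrightarrow> holds \<rho> c \<longleftrightarrow> holds \<rho>' c"
  by (cases c) auto

lemma ex_variable_bound: "\<exists>m::nat. 0 < m \<and> (\<forall>c\<in>set cs. set_cstr c \<subseteq> {..<m})"
proof -
  have "finite (\<Union>c\<in>set cs. set_cstr c)" by auto
  then obtain m where "\<forall>i\<in>(\<Union>c\<in>set cs. set_cstr c). i < m"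
    using finite_nat_set_iff_bounded by blast
  then show ?thesis by (intro exI[of _ "Suc m"]) (auto intro: less_SucI)
qed

text \<open>Variable \<open>i\<close> becomes \<open>(i, 0)\<close>, and the pairs
  \<open>(i, s)\<close> carry its certificate of nonnegativity. As
  \<open>prod_encode (0, 0) = 0\<close>, the parameter stays at variable 0.\<close>

lemma natural_to_integer_solution:
  fixes cs :: "nat cstr list"
  shows "\<exists>ds :: nat cstr list. \<forall>n. (\<exists>\<rho> :: nat \<Rightarrow> nat. \<rho> 0 = n \<and> (\<forall>c\<in>set cs. holds \<rho> c)) \<longleftrightarrow>
    (\<exists>\<rho> :: nat \<Rightarrow> int. \<rho> 0 = int n \<and> (\<forall>c\<in>set ds. holds \<rho> c))"
proof -
  obtain m where m: "0 < m" "\<And>c. c \<in> set cs \<Longrightarrow> set_cstr c \<subseteq> {..<m}"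
    using ex_variable_bound[of cs] by blast
  define ds where "ds = map (map_cstr prod_encode)
    (map (map_cstr (\<lambda>i. (i, 0))) cs @ concat (map nonneg_cstrs [0..<m]))"
  have ds: "(\<forall>c\<in>set ds. holds \<rho> c) \<longleftrightarrow> (\<forall>c\<in>set cs. holds (\<lambda>i. \<rho> (prod_encode (i, 0))) c) \<and>
      (\<forall>i<m. \<forall>c\<in>set (nonneg_cstrs i). holds (\<lambda>p. \<rho> (prod_encode p)) c)"
    for \<rho> :: "nat \<Rightarrow> int"
    unfolding ds_def by (auto simp: holds_map ball_Un)
  have enc0: "prod_encode (0, 0) = 0" by (simp add: prod_encode_def)
  have "(\<exists>\<rho> :: nat \<Rightarrow> nat. \<rho> 0 = n \<and> (\<forall>c\<in>set cs. holds \<rho> c)) \<longleftrightarrow>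
    (\<exists>\<rho> :: nat \<Rightarrow> int. \<rho> 0 = int n \<and> (\<forall>c\<in>set ds. holds \<rho> c))" for n
  proof
    assume "\<exists>\<rho> :: nat \<Rightarrow> nat. \<rho> 0 = n \<and> (\<forall>c\<in>set cs. holds \<rho> c)"
    then obtain \<rho> :: "nat \<Rightarrow> nat" where \<rho>: "\<rho> 0 = n" "\<forall>c\<in>set cs. holds \<rho> c" by blast
    have "\<forall>j. \<exists>\<tau>. \<tau> 0 = int (\<rho> j) \<and> (\<forall>i \<rho>'. (\<forall>s. \<rho>' (i, s) = \<tau> s) \<longrightarrow>
        (\<forall>c\<in>set (nonneg_cstrs i). holds \<rho>' c))"
      by (intro allI nonneg_cstrs_complete) simp
    from choice[OF this] obtain \<tau> where \<tau>: "\<And>j. \<tau> j 0 = int (\<rho> j)"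
      "\<And>j i \<rho>'. (\<forall>s. \<rho>' (i, s) = \<tau> j s) \<Longrightarrow> (\<forall>c\<in>set (nonneg_cstrs i). holds \<rho>' c)"
      by blast
    define \<rho>' where "\<rho>' k = (case prod_decode k of (i, s) \<Rightarrow> \<tau> i s)" for k
    have enc: "\<rho>' (prod_encode (i, s)) = \<tau> i s" for i s by (simp add: \<rho>'_def)
    have "\<forall>c\<in>set cs. holds (\<lambda>i. \<rho>' (prod_encode (i, 0))) c"
      using \<rho>(2) by (simp add: enc \<tau>(1) holds_of_nat)
    moreover have "\<forall>c\<in>set (nonneg_cstrs i). holds (\<lambda>p. \<rho>' (prod_encode p)) c" for i
      by (rule \<tau>(2)[of _ i i]) (simp add: enc)
    moreover have "\<rho>' 0 = int n" using enc[of 0 0] \<tau>(1) \<rho>(1) enc0 by simp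
    ultimately show "\<exists>\<rho> :: nat \<Rightarrow> int. \<rho> 0 = int n \<and> (\<forall>c\<in>set ds. holds \<rho> c)"
      unfolding ds by blast
  next
    assume "\<exists>\<rho> :: nat \<Rightarrow> int. \<rho> 0 = int n \<and> (\<forall>c\<in>set ds. holds \<rho> c)"
    then obtain \<rho> :: "nat \<Rightarrow> int" where \<rho>: "\<rho> 0 = int n"
      "\<forall>c\<in>set cs. holds (\<lambda>i. \<rho> (prod_encode (i, 0))) c"
      "\<forall>i<m. \<forall>c\<in>set (nonneg_cstrs i). holds (\<lambda>p. \<rho> (prod_encode p)) c"
      unfolding ds by blast
    define \<rho>' where "\<rho>' i = nat (\<rho> (prod_encode (i, 0)))" for i
    have nn: "int (\<rho>' i) = \<rho> (prod_encode (i, 0))" if "i < m" for i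
      using nonneg_cstrs_sound[of i "\<lambda>p. \<rho> (prod_encode p)"] \<rho>(3) that by (simp add: \<rho>'_def)
    have "holds \<rho>' c" if "c \<in> set cs" for c
    proof -
      have "holds (\<lambda>i. int (\<rho>' i)) c \<longleftrightarrow> holds (\<lambda>i. \<rho> (prod_encode (i, 0))) c"
        using m(2)[OF that] nn by (intro holds_cong) auto
      then show ?thesis using \<rho>(2) that by (simp add: holds_of_nat)
    qed
    moreover have "\<rho>' 0 = n" by (simp add: \<rho>'_def enc0 \<rho>(1))
    ultimately show "\<exists>\<rho> :: nat \<Rightarrow> nat. \<rho> 0 = n \<and> (\<forall>c\<in>set cs. holds \<rho> c)" by blast
  qed
  then show ?thesis by blast
qed

lemma dioph_solvable_K2:
  assumes "dioph P"
  shows "\<exists>sys. \<forall>n. P (\<lambda>_. n) \<longleftrightarrow> solvable_K2 (param_eq n # sys)"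
proof -
  obtain cs where cs: "\<And>v. P v \<longleftrightarrow> (\<exists>w :: nat \<Rightarrow> nat. \<forall>c\<in>set cs. holds (case_sum w v) c)"
    using dioph_normal_form[OF assms] by blast
  let ?f = "case_sum Suc (\<lambda>_. 0) :: nat + nat \<Rightarrow> nat"
  have f: "(\<lambda>i. \<rho> (?f i)) = case_sum (\<lambda>i. \<rho> (Suc i)) (\<lambda>_. \<rho> 0)" for \<rho> :: "nat \<Rightarrow> nat"
    by (auto split: sum.split)
  have f': "(\<lambda>i. case_nat n w (?f i)) = case_sum w (\<lambda>_. n)" for n and w :: "nat \<Rightarrow> nat"
    by (auto split: sum.split)
  have P: "P (\<lambda>_. n) \<longleftrightarrow> (\<exists>\<rho> :: nat \<Rightarrow> nat. \<rho> 0 = n \<and> (\<forall>c\<in>set (map (map_cstr ?f) cs). holds \<rho> c))" for n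
  proof
    assume "P (\<lambda>_. n)"
    then obtain w where "\<forall>c\<in>set cs. holds (case_sum w (\<lambda>_. n)) c" using cs by blast
    then show "\<exists>\<rho> :: nat \<Rightarrow> nat. \<rho> 0 = n \<and> (\<forall>c\<in>set (map (map_cstr ?f) cs). holds \<rho> c)"
      by (intro exI[of _ "case_nat n w"]) (simp add: holds_map f')
  next
    assume "\<exists>\<rho> :: nat \<Rightarrow> nat. \<rho> 0 = n \<and> (\<forall>c\<in>set (map (map_cstr ?f) cs). holds \<rho> c)"
    then obtain \<rho> :: "nat \<Rightarrow> nat" where "\<rho> 0 = n"
      "\<forall>c\<in>set cs. holds (case_sum (\<lambda>i. \<rho> (Suc i)) (\<lambda>_. \<rho> 0)) c"
      by (auto simp: holds_map f)
    then show "P (\<lambda>_. n)" unfolding cs by blast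
  qed
  obtain ds where ds: "\<And>n. (\<exists>\<rho> :: nat \<Rightarrow> nat. \<rho> 0 = n \<and> (\<forall>c\<in>set (map (map_cstr ?f) cs). holds \<rho> c)) \<longleftrightarrow>
    (\<exists>\<rho> :: nat \<Rightarrow> int. \<rho> 0 = int n \<and> (\<forall>c\<in>set ds. holds \<rho> c))"
    using natural_to_integer_solution[of "map (map_cstr ?f) cs"] by blast
  obtain m where m: "0 < m" "\<And>c. c \<in> set ds \<Longrightarrow> set_cstr c \<subseteq> {..<m}"
    using ex_variable_bound[of ds] by blast
  show ?thesis
    by (intro exI[of _ "concat (map var_eqs [0..<m]) @ map cstr_eq ds"] allI)
      (simp only: P ds solvable_iff_integer_solution[OF m(2,1)])
qed

section \<open>Computing the code of the diagonal instance\<close>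

lemma eval_Comp1: "eval g xs y \<Longrightarrow> eval f [y] z \<Longrightarrow> eval (Comp f [g]) xs z"
  by (rule ev_Comp[of _ "[g]" "[y]"]) auto

lemma eval_Comp2: "eval g xs y \<Longrightarrow> eval h xs y' \<Longrightarrow> eval f [y, y'] z \<Longrightarrow> eval (Comp f [g, h]) xs z"
  by (rule ev_Comp[of _ "[g, h]" "[y, y']"]) auto

lemma eval_Proj: "i < length xs \<Longrightarrow> y = xs ! i \<Longrightarrow> eval (Proj i) xs y"
  by (simp add: ev_Proj)

definition rec_add :: recf where
  "rec_add = Prim (Proj 0) (Comp Sf [Proj 1])"

lemma eval_rec_add: "eval rec_add [a, b] (a + b)"
  unfolding rec_add_def
proof (induction a)
  case 0
  show ?case by (auto intro!: ev_Prim0 eval_Proj)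
next
  case (Suc a)
  show ?case
    by (rule ev_PrimS[OF Suc]) (auto intro!: eval_Comp1 eval_Proj ev_S)
qed

text \<open>\<open>prod_encode (a, b)\<close> is \<open>triangle (a + b) + a\<close>, and
  \<open>list_encode\<close> applies \<open>Suc\<close> to such pairs, so triangular numbers and
  addition suffice to prepend to a coded list.\<close>

definition rec_triangle :: recf where
  "rec_triangle = Prim Zf (Comp rec_add [Proj 1, Comp Sf [Proj 0]])"

lemma eval_rec_triangle: "eval rec_triangle [n] (triangle n)"
  unfolding rec_triangle_def
proof (induction n)
  case 0
  show ?case by (auto intro!: ev_Prim0 ev_Z)
next
  case (Suc n)
  have "eval (Comp rec_add [Proj 1, Comp Sf [Proj 0]]) [n, triangle n] (triangle n + Suc n)"
    by (rule eval_Comp2[OF _ _ eval_rec_add]) (auto intro!: eval_Comp1 eval_Proj ev_S)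
  then show ?case using ev_PrimS[OF Suc] by simp
qed

fun rec_const :: "nat \<Rightarrow> recf" where
  "rec_const 0 = Zf"
| "rec_const (Suc n) = Comp Sf [rec_const n]"

lemma eval_rec_const: "eval (rec_const n) xs n"
  by (induction n) (auto intro!: ev_Z ev_S eval_Comp1)

definition enc_equation :: "equation \<Rightarrow> nat" where
  "enc_equation e = list_encode (map enc_letter e)"

text \<open>The letter \<open>x\<close> has code 0, so prepending it sends a code \<open>p\<close>
  to \<open>Suc (triangle p)\<close>.\<close>

definition rec_param :: recf where
  "rec_param = Prim (rec_const (enc_equation (param_eq 0))) (Comp Sf [Comp rec_triangle [Proj 1]])"

lemma eval_rec_param: "eval rec_param [n] (enc_equation (param_eq n))"
  unfolding rec_param_def
proof (induction n)
  case 0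
  show ?case by (auto intro!: ev_Prim0 eval_rec_const)
next
  case (Suc n)
  have "enc_equation (param_eq (Suc n)) = Suc (triangle (enc_equation (param_eq n)))"
    by (simp add: enc_equation_def param_eq_def enc_letter_def prod_encode_def)
  then show ?case
    by (intro ev_PrimS[OF Suc]) (auto intro!: eval_Comp1 eval_Proj ev_S eval_rec_triangle)
qed

text \<open>The input is used twice: as the exponent in the parameter equation and as the code of
  the remaining system.\<close>

definition rec_instance :: recf where
  "rec_instance = Comp Sf [Comp rec_add [Comp rec_triangle [Comp rec_add [rec_param, Proj 0]], rec_param]]"

lemma eval_rec_instance: "eval rec_instance [enc_system sys] (enc_system (param_eq (enc_system sys) # sys))"
proof -
  let ?n = "enc_system sys"
  have "enc_system (param_eq ?n # sys)
      = Suc (triangle (enc_equation (param_eq ?n) + ?n) + enc_equation (param_eq ?n))"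
    by (simp add: enc_system_def enc_equation_def prod_encode_def)
  moreover have "eval (Comp rec_add [rec_param, Proj 0]) [?n] (enc_equation (param_eq ?n) + ?n)"
    by (rule eval_Comp2[OF eval_rec_param _ eval_rec_add]) (simp add: eval_Proj)
  ultimately show ?thesis
    unfolding rec_instance_def
    by (auto intro!: eval_Comp1[OF eval_Comp2[OF eval_Comp1 eval_rec_param eval_rec_add]]
        eval_rec_triangle ev_S)
qed

theorem theorem4p3:
  shows "\<not> diophantine_decidable_K2"
proof
  assume diophantine_decidable_K2
  then obtain r where r: "\<And>sys. eval r [enc_system sys] (if solvable_K2 sys then 1 else 0)"
    unfolding diophantine_decidable_K2_def by blast
  define d where "d = Comp r [rec_instance]"
  have d: "eval d [enc_system sys] (if solvable_K2 (param_eq (enc_system sys) # sys) then 1 else 0)" for sys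
    unfolding d_def by (rule eval_Comp1[OF eval_rec_instance r])
  have "dioph (\<lambda>v. \<exists>z. z = 0 \<and> eval d (map v [0]) z)"
  proof (intro dioph_ex dioph_conj)
    show "dioph (\<lambda>v. eval d (map (\<lambda>i. v (Suc i)) [0]) (v 0))"
      using dioph_eval[of d "[1]" 0] by simp
  qed (intro dioph_intros)
  then obtain sys where sys: "\<And>n. eval d [n] 0 \<longleftrightarrow> solvable_K2 (param_eq n # sys)"
    using dioph_solvable_K2 by force
  show False
  proof (cases "solvable_K2 (param_eq (enc_system sys) # sys)")
    case True
    then have "eval d [enc_system sys] 0" "eval d [enc_system sys] 1"
      using d[of sys] sys by auto
    then show False using eval_deterministic by fastforce
  next
    case False
    then show False using d[of sys] sys by auto
  qed
qed

end
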